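(* Let $n\ge 2$, $R>0$ and $\varepsilon>0$. Let $f\in C^\infty(B_{R+\varepsilon})$ be such that $D_x^\alpha \mathcal{R}(f)(0,t)=0$ for all multi-indices $\alpha$ and all $t\in[0,R]$. Assume that $\mathcal{R}(f)(x,R)=0$ for all $x\in B_\varepsilon$. Then $f(x)=0$ for all $x\in B_{R+\varepsilon}$.
   Context: For $\rho>0$, $B_\rho\subset\mathbb{R}^n$ denotes the open ball of radius $\rho$ centered at $0$. For $x\in\mathbb{R}^n$ and $t>0$, $S(x,t)\subset\mathbb{R}^n$ is the sphere of radius $t$ centered at $x$, $d\sigma$ is its surface measure and $|S(x,t)|$ its total measure. The spherical mean transform of a function $f$ is $$\mathcal{R}(f)(x,t)=\frac{1}{|S(x,t)|}\int_{S(x,t)} f(y)\,d\sigma(y),\qquad \mathcal{R}(f)(x,0)=f(x),$$ defined whenever $S(x,t)$ is contained in the domain of $f$; for $f$ defined on $B_{R+\varepsilon}$ this is the case when $|x|+t<R+\varepsilon$. $D_x^\alpha$ denotes the partial derivative of order $\alpha$ in the variable $x$. *)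

theory Defs
  imports "HOL-Analysis.Analysis"
begin

text \<open>
  The coordinates of \<open>\<real>\<^sup>n\<close> are indexed by an ordered finite type \<open>'n\<close>; the order is used
  only to fix the order in which the partial derivatives in \<open>D\<^sup>\<alpha>\<close> are taken. Functions on an
  open set are represented by total functions whose values off that set are arbitrary;
  \<open>partial_deriv\<close> at a point depends only on the values near that point.
\<close>

definition partial_deriv ::
    "'n::finite \<Rightarrow> (real^'n \<Rightarrow> 'b::real_normed_vector) \<Rightarrow> real^'n \<Rightarrow> 'b"
  where "partial_deriv i g x = vector_derivative (\<lambda>s. g (x + s *\<^sub>R axis i 1)) (at 0)"

text \<open>\<open>D\<^sup>\<alpha> = \<partial>\<^sub>1\<^bsup>\<alpha>\<^sub>1\<^esup> \<dots> \<partial>\<^sub>n\<^bsup>\<alpha>\<^sub>n\<^esup>\<close>, for a multi-index \<open>\<alpha>\<close>.\<close>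

definition multi_deriv ::
    "('n::{finite,wellorder} \<Rightarrow> nat) \<Rightarrow> (real^('n::{finite,wellorder}) \<Rightarrow> 'b::real_normed_vector) \<Rightarrow> real^('n::{finite,wellorder}) \<Rightarrow> 'b"
  where "multi_deriv \<alpha> g =
    foldr (\<lambda>i. partial_deriv i ^^ \<alpha> i) (sorted_list_of_set UNIV) g"

text \<open>Class \<open>C\<^sup>k\<close> on an open set \<open>U\<close>: all iterated partial derivatives of order at most \<open>k\<close>
  exist and are continuous on \<open>U\<close>.\<close>

primrec Ck_on :: "nat \<Rightarrow> (real^'n::finite) set \<Rightarrow> (real^'n \<Rightarrow> 'b::real_normed_vector) \<Rightarrow> bool"
  where
    "Ck_on 0 U g \<longleftrightarrow> continuous_on U g"
  | "Ck_on (Suc k) U g \<longleftrightarrow> continuous_on U g \<and>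
       (\<forall>i. (\<forall>x\<in>U. (\<lambda>s. g (x + s *\<^sub>R axis i 1)) differentiable (at 0)) \<and>
            Ck_on k U (partial_deriv i g))"

definition Cinf_on :: "(real^'n::finite) set \<Rightarrow> (real^'n \<Rightarrow> 'b::real_normed_vector) \<Rightarrow> bool"
  where "Cinf_on U g \<longleftrightarrow> (\<forall>k. Ck_on k U g)"

text \<open>
  Surface measure on the sphere \<open>S(x,t)\<close>, \<open>t > 0\<close>, as the cone measure of polar coordinates:
  for Borel \<open>A \<subseteq> S(x,t)\<close>,
  \<open>\<sigma>(A) = (n/t) vol {x + r (y - x) | y \<in> A, 0 < r \<le> 1}\<close>.
  It is obtained by pushing Lebesgue measure on the punctured ball forward along the radial
  projection. The factor comes from
  \<open>vol {x + r (y - x) | y \<in> A, 0 < r \<le> 1} = (\<integral>\<^sub>0\<^sup>t (s/t)\<^bsup>n-1\<^esup> ds) \<sigma>(A) = (t/n) \<sigma>(A)\<close>.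
\<close>

definition sphere_measure :: "real^'n::finite \<Rightarrow> real \<Rightarrow> (real^'n) measure"
  where "sphere_measure x t =
    scale_measure (ennreal (real CARD('n) / t))
      (distr (restrict_space lborel (cball x t - {x})) borel
        (\<lambda>y. x + (t / norm (y - x)) *\<^sub>R (y - x)))"

text \<open>The integral is a set integral over \<open>S(x,t)\<close>, so that only the values of \<open>f\<close> on the
  sphere enter: \<open>f\<close> need not be measurable outside its domain.\<close>

definition spherical_mean ::
    "(real^'n::finite \<Rightarrow> 'b::{banach,second_countable_topology}) \<Rightarrow> real^'n \<Rightarrow> real \<Rightarrow> 'b"
  where "spherical_mean f x t =
    (if t = 0 then f x
     else (1 / measure (sphere_measure x t) (sphere x t)) *\<^sub>R
            (LINT y:sphere x t|sphere_measure x t. f y))"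

end

theory Submission
  imports Defs
begin

text \<open>
  If every derivative of \<open>g\<close> has mean zero over the spheres of radius \<open>t \<le> T\<close> about a point \<open>a\<close>, then
  \<open>g = 0\<close> on the ball of radius \<open>T\<close> about \<open>a\<close>: by the divergence theorem the property passes from \<open>g\<close>
  to \<open>y\<^sub>i g\<close>, hence to \<open>p g\<close> for all polynomials \<open>p\<close>, and polynomials are dense in the continuous functions
  on a sphere. In particular \<open>f = 0\<close> on the ball of radius \<open>R\<close> about \<open>0\<close>.

  Let \<open>g\<close> be a derivative of \<open>f\<close>, \<open>v(x,t)\<close> its mean over \<open>S(x,t)\<close> and \<open>W(s,t)\<close> the mean of \<open>v(\<cdot>,t)\<close> over
  \<open>S(0,s)\<close>. Then \<open>W\<close> solves the Euler-Poisson-Darboux equation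
  \<open>W\<^sub>s\<^sub>s + ((n-1)/s) W\<^sub>s = W\<^sub>t\<^sub>t + ((n-1)/t) W\<^sub>t\<close>, with \<open>W(s,R) = 0\<close> for \<open>s < \<epsilon>\<close> and zero Cauchy data at
  \<open>s = 0\<close> for \<open>t \<le> R\<close>. An energy estimate in the direction of \<open>s\<close> shows \<open>W = 0\<close> for \<open>s < \<epsilon>\<close>, \<open>0 < t \<le> R\<close>.
  So the derivatives of \<open>v(\<cdot>,t)\<close> have mean zero over all spheres about \<open>0\<close> of radius less than \<open>\<epsilon>\<close>, and by
  the first step \<open>v(x,t) = 0\<close> for \<open>|x| < \<epsilon>\<close>. The first step about such an \<open>x\<close> gives \<open>f = 0\<close> on the ball of
  radius \<open>R\<close> about \<open>x\<close>.
\<close>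

section \<open>The measure on the unit sphere\<close>

text \<open>The cone measure of the unit sphere, not normalised: the total mass is the volume of the unit
  ball. By scaling, all \<^const>\<open>sphere_measure\<close>s are multiples of its images under affine maps.\<close>

definition usm :: "(real^'n::finite) measure"
  where "usm = distr (restrict_space lborel (cball 0 1 - {0}))
    (restrict_space borel (sphere 0 1)) sgn"

lemma space_usm [simp]: "space usm = sphere 0 1"
  by (simp add: usm_def)

lemma sets_usm [measurable_cong]: "sets usm = sets (restrict_space borel (sphere 0 1))"
  by (simp add: usm_def)

lemma measurable_sgn_sphere:
  "sgn \<in> restrict_space lborel (cball 0 1 - {0 :: real^'n::finite}) \<rightarrow>\<^sub>M
     restrict_space borel (sphere 0 1)"
proof (rule measurable_restrict_space2)
  show "sgn \<in> space (restrict_space lborel (cball 0 1 - {0 :: real^'n})) \<rightarrow> sphere 0 1"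
    by (auto simp: norm_sgn)
  show "sgn \<in> restrict_space lborel (cball 0 1 - {0 :: real^'n}) \<rightarrow>\<^sub>M borel"
    unfolding sgn_div_norm by (intro measurable_restrict_space1) measurable
qed

lemma sphere_pullback_sets [measurable]:
  assumes "A \<in> sets borel"
  shows "{y \<in> cball 0 1 - {0 :: real^'n::finite}. sgn y \<in> A} \<in> sets lborel"
proof -
  have [measurable]: "A \<in> sets borel" "(sgn :: real^'n \<Rightarrow> _) \<in> borel_measurable borel"
    using assms unfolding sgn_div_norm by measurable
  have "{y \<in> cball 0 1 - {0 :: real^'n}. sgn y \<in> A} =
      {y \<in> space borel. y \<in> cball 0 1 \<and> y \<noteq> 0 \<and> sgn y \<in> A}"
    by auto
  also have "\<dots> \<in> sets borel" unfolding mem_cball by measurable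
  finally show ?thesis by simp
qed

lemma emeasure_usm:
  assumes "A \<in> sets borel" "A \<subseteq> sphere 0 1"
  shows "emeasure usm A = emeasure lborel {y \<in> cball 0 1 - {0 :: real^'n::finite}. sgn y \<in> A}"
proof -
  have "emeasure usm A = emeasure (restrict_space lborel (cball 0 1 - {0}))
      (sgn -` A \<inter> space (restrict_space lborel (cball 0 1 - {0})))"
    unfolding usm_def using assms measurable_sgn_sphere
    by (intro emeasure_distr) (auto simp: sets_restrict_space_iff)
  also have "sgn -` A \<inter> space (restrict_space lborel (cball 0 1 - {0})) =
      {y \<in> cball 0 1 - {0}. sgn y \<in> A}"
    by auto
  also have "emeasure (restrict_space lborel (cball 0 1 - {0})) \<dots> = emeasure lborel \<dots>"
    by (intro emeasure_restrict_space) auto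
  finally show ?thesis .
qed

lemma emeasure_lborel_cball_punctured:
  "emeasure lborel (cball 0 1 - {0 :: real^'n::finite}) = emeasure lborel (cball 0 1 :: (real^'n) set)"
  by (intro emeasure_Diff_null_set) (auto intro: finite_imp_null_set_lborel)

lemma emeasure_usm_space: "emeasure usm (sphere 0 1 :: (real^'n::finite) set) = emeasure lborel (cball 0 1 :: (real^'n) set)"
proof -
  have "{y \<in> cball 0 1 - {0 :: real^'n}. sgn y \<in> sphere 0 1} = cball 0 1 - {0}"
    by (auto simp: norm_sgn)
  then show ?thesis
    using emeasure_usm[of "sphere 0 1 :: (real^'n) set"] by (simp add: emeasure_lborel_cball_punctured)
qed

lemma finite_measure_usm: "finite_measure (usm :: (real^'n::finite) measure)"
  using emeasure_lborel_cball_finite[of "0 :: real^'n" 1]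
  by (intro finite_measureI) (simp add: emeasure_usm_space)

interpretation usm: finite_measure "usm :: (real^'n::finite) measure"
  by (rule finite_measure_usm)

lemma measure_usm_pos: "measure usm (sphere 0 1 :: (real^'n::finite) set) > 0"
proof -
  have "measure usm (sphere 0 1 :: (real^'n) set) = measure lborel (cball 0 1 :: (real^'n) set)"
    by (simp add: measure_def emeasure_usm_space)
  then show ?thesis by (simp add: content_cball_pos)
qed

lemma measurable_usm_continuous:
  assumes "continuous_on (sphere 0 1) k"
  shows "k \<in> borel_measurable usm"
  using borel_measurable_continuous_on_restrict[OF assms]
  by (simp cong: measurable_cong_sets add: sets_usm)

lemma integrable_usm:
  fixes k :: "real^'n::finite \<Rightarrow> 'b::{banach,second_countable_topology}"
  assumes "continuous_on (sphere 0 1) k"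
  shows "integrable usm k"
proof -
  have "compact (k ` sphere 0 1)" using assms by (intro compact_continuous_image) auto
  then obtain B where "\<And>y. y \<in> k ` sphere 0 1 \<Longrightarrow> norm y \<le> B"
    using bounded_iff compact_imp_bounded by metis
  then show ?thesis
    by (intro usm.integrable_const_bound[where B=B] measurable_usm_continuous assms AE_I2) auto
qed

text \<open>The measure charges every nonempty relatively open part \<open>V\<close> of the sphere:
  the cone over \<open>V\<close> contains a nonempty open subset of the unit ball, which has
  positive Lebesgue measure. Hence a continuous \<open>k\<close> of this kind has no positive
  value.\<close>

lemma usm_nonneg_zero:
  fixes k :: "real^'n::finite \<Rightarrow> real"
  assumes k: "continuous_on (sphere 0 1) k" and "\<And>w. w \<in> sphere 0 1 \<Longrightarrow> 0 \<le> k w"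
    and "(\<integral>w. k w \<partial>usm) = 0" and "w \<in> sphere 0 1"
  shows "k w = 0"
proof (rule ccontr)
  assume "k w \<noteq> 0"
  then have pos: "0 < k w" using assms by force
  have "AE w in usm. 0 \<le> k w" by (rule AE_I2) (simp add: assms(2))
  from integral_nonneg_eq_0_iff_AE[OF integrable_usm[OF k] this]
  have AE: "AE w in usm. k w = 0" using assms(3) by blast
  define V where "V = {w \<in> sphere 0 1. k w \<noteq> 0}"
  have V_eq: "V = sphere 0 1 \<inter> k -` (- {0})" by (auto simp: V_def)
  have "openin (top_of_set (sphere 0 1)) V"
    unfolding V_eq by (intro continuous_openin_preimage_gen[OF k]) auto
  then obtain O' where O': "open O'" "V = sphere 0 1 \<inter> O'" by (auto simp: openin_open)
  have Vb: "V \<in> sets borel" using O' by (simp add: borel_closed)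
  then have Vs: "V \<in> sets usm" using O' by (simp add: sets_usm sets_restrict_space_iff)
  have "emeasure usm V = 0"
    using AE by (subst (asm) AE_iff_measurable[OF Vs]) (auto simp: V_def)
  then have null: "emeasure lborel {y \<in> cball 0 1 - {0 :: real^'n}. sgn y \<in> V} = 0"
    using emeasure_usm[OF Vb] O' by simp
  \<comment> \<open>The point \<open>w\<close> lies on the boundary of the unit ball; its half lies
    in the open ball and still on the cone over \<open>V\<close>.\<close>
  have "(1/2) *\<^sub>R w \<in> sgn -` O' \<inter> (- {0})"
  proof -
    have "w \<in> V" using pos assms(4) by (simp add: V_def)
    moreover have "sgn ((1/2) *\<^sub>R w) = w" "w \<noteq> 0" using assms(4) by (auto simp: sgn_div_norm)
    ultimately show ?thesis using O'(2) by simp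
  qed
  moreover have "open (sgn -` O' \<inter> (- {0 :: real^'n}))"
    unfolding Int_commute[of "sgn -` O'"] sgn_div_norm
    using O' by (intro continuous_open_preimage continuous_intros) auto
  moreover have "(1/2) *\<^sub>R w \<in> ball 0 1" using assms by auto
  ultimately have "open (sgn -` O' \<inter> (- {0 :: real^'n}) \<inter> ball 0 1)"
      "sgn -` O' \<inter> (- {0 :: real^'n}) \<inter> ball 0 1 \<noteq> {}"
    by blast+
  then have "emeasure lborel (sgn -` O' \<inter> (- {0 :: real^'n}) \<inter> ball 0 1) \<noteq> 0"
    using open_not_negligible[of "sgn -` O' \<inter> (- {0 :: real^'n}) \<inter> ball 0 1"]
    by (auto simp: negligible_iff_null_sets null_sets_def emeasure_completion)
  moreover have "emeasure lborel (sgn -` O' \<inter> (- {0 :: real^'n}) \<inter> ball 0 1) \<le>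
      emeasure lborel {y \<in> cball 0 1 - {0 :: real^'n}. sgn y \<in> V}"
    using O' by (intro emeasure_mono sphere_pullback_sets Vb) (auto simp: norm_sgn)
  ultimately show False using null by simp
qed

lemma integral_usm_cong:
  "(\<And>w. w \<in> sphere 0 1 \<Longrightarrow> k w = k' w) \<Longrightarrow> (\<integral>w. k w \<partial>usm) = (\<integral>w. k' w \<partial>usm)"
  by (intro Bochner_Integration.integral_cong) auto

section \<open>Spheres of arbitrary centre and radius in terms of the unit sphere\<close>

text \<open>The substitution \<open>y = x + t z\<close> carries the punctured unit ball to the one
  of radius \<open>t\<close> about \<open>x\<close> and commutes with the radial projections. Its
  Jacobian gives \<open>t ^ CARD('n)\<close>; the remaining factor is the one in
  \<open>sphere_measure\<close>.\<close>

lemma sphere_measure_eq: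
  fixes x :: "real^'n::finite"
  assumes "t > 0"
  shows "sphere_measure x t = density (distr usm borel (\<lambda>w. x + t *\<^sub>R w))
    (\<lambda>_. ennreal (real CARD('n) / t * t ^ CARD('n)))"
proof (rule measure_eqI)
  show "sets (sphere_measure x t) = sets (density (distr usm borel (\<lambda>w. x + t *\<^sub>R w))
    (\<lambda>_. ennreal (real CARD('n) / t * t ^ CARD('n))))"
    by (simp add: sphere_measure_def)
  fix A assume "A \<in> sets (sphere_measure x t)"
  then have A [measurable]: "A \<in> sets borel" by (simp add: sphere_measure_def)
  define p where "p y = x + (t / norm (y - x)) *\<^sub>R (y - x)" for y
  have [measurable]: "p \<in> borel_measurable borel" unfolding p_def by measurable
  define B where "B = {y \<in> cball x t - {x}. p y \<in> A}"
  have "B = {y \<in> space borel. y \<in> cball x t \<and> y \<noteq> x \<and> p y \<in> A}" by (auto simp: B_def)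
  also have "\<dots> \<in> sets borel" unfolding mem_cball by measurable
  finally have Bs: "B \<in> sets borel" .
  have "emeasure (distr (restrict_space lborel (cball x t - {x})) borel p) A =
      emeasure (restrict_space lborel (cball x t - {x})) (p -` A \<inter> space (restrict_space lborel (cball x t - {x})))"
    by (intro emeasure_distr measurable_restrict_space1) auto
  also have "p -` A \<inter> space (restrict_space lborel (cball x t - {x})) = B"
    by (auto simp: B_def)
  also have "emeasure (restrict_space lborel (cball x t - {x})) B = emeasure lborel B"
    by (intro emeasure_restrict_space) (auto simp: B_def)
  also have "\<dots> = emeasure (density (distr lborel borel (\<lambda>z. x + t *\<^sub>R z)) (\<lambda>_. ennreal (\<bar>t\<bar> ^ DIM(real^'n)))) B"
    using lborel_affine[of t x] \<open>t > 0\<close> by simp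
  also have "\<dots> = ennreal (\<bar>t\<bar> ^ DIM(real^'n)) * emeasure lborel ((\<lambda>z. x + t *\<^sub>R z) -` B)"
    using Bs by (simp add: emeasure_density_const emeasure_distr)
  also have "(\<lambda>z. x + t *\<^sub>R z) -` B = {y \<in> cball 0 1 - {0}. sgn y \<in> {w \<in> sphere 0 1. x + t *\<^sub>R w \<in> A}}"
  proof -
    have "p (x + t *\<^sub>R z) = x + t *\<^sub>R sgn z" for z
      using \<open>t > 0\<close> by (simp add: p_def sgn_div_norm divide_inverse mult.commute mult.left_commute)
    then show ?thesis
      using \<open>t > 0\<close> by (auto simp: B_def dist_norm norm_sgn)
  qed
  also have "emeasure lborel \<dots> = emeasure usm {w \<in> sphere 0 1. x + t *\<^sub>R w \<in> A}"
  proof (rule emeasure_usm[symmetric])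
    have "{w \<in> sphere 0 1. x + t *\<^sub>R w \<in> A} = {w \<in> space borel. w \<in> sphere 0 1 \<and> x + t *\<^sub>R w \<in> A}" by auto
    also have "\<dots> \<in> sets borel" unfolding mem_sphere by measurable
    finally show "{w \<in> sphere 0 1. x + t *\<^sub>R w \<in> A} \<in> sets borel" .
  qed auto
  also have "\<dots> = emeasure (distr usm borel (\<lambda>w. x + t *\<^sub>R w)) A"
    by (subst emeasure_distr) (auto intro!: measurable_usm_continuous continuous_intros arg_cong[where f="emeasure usm"])
  finally show "emeasure (sphere_measure x t) A = emeasure (density (distr usm borel (\<lambda>w. x + t *\<^sub>R w))
    (\<lambda>_. ennreal (real CARD('n) / t * t ^ CARD('n)))) A"
    using \<open>t > 0\<close> ennreal_mult[of "real CARD('n) / t" "t ^ CARD('n)"]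
    unfolding sphere_measure_def p_def[symmetric]
    by (simp add: emeasure_density_const mult.assoc del: times_divide_eq_left)
qed

text \<open>The scaling constant cancels between the integral and the total mass. As
  \<open>f\<close> is only known to be continuous on the sphere, the indicator stays in the
  integrand until measurability is settled.\<close>

lemma spherical_mean_eq_usm:
  fixes f :: "real^'n::finite \<Rightarrow> 'b::{banach,second_countable_topology}"
  assumes "t > 0" and f: "continuous_on (sphere x t) f"
  shows "spherical_mean f x t =
    (1 / measure usm (sphere 0 1 :: (real^'n) set)) *\<^sub>R (\<integral>w. f (x + t *\<^sub>R w) \<partial>usm)"
proof -
  define c where "c = real CARD('n) / t * t ^ CARD('n)"
  have c: "c > 0" using \<open>t > 0\<close> by (auto simp: c_def)
  have aff: "(\<lambda>w. x + t *\<^sub>R w) \<in> borel_measurable usm"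
    by (intro measurable_usm_continuous continuous_intros)
  have pre: "(\<lambda>w. x + t *\<^sub>R w) -` sphere x t \<inter> sphere 0 1 = sphere 0 1"
    using \<open>t > 0\<close> by (auto simp: dist_norm)
  have "(LINT y:sphere x t|sphere_measure x t. f y) =
      (\<integral>y. c *\<^sub>R (indicator (sphere x t) y *\<^sub>R f y) \<partial>(distr usm borel (\<lambda>w. x + t *\<^sub>R w)))"
    unfolding sphere_measure_eq[OF \<open>t > 0\<close>] c_def[symmetric] set_lebesgue_integral_def
    using c f by (intro integral_density) (auto intro!: borel_measurable_continuous_on_indicator)
  also have "\<dots> = (\<integral>w. c *\<^sub>R (indicator (sphere x t) (x + t *\<^sub>R w) *\<^sub>R f (x + t *\<^sub>R w)) \<partial>usm)"
    using f by (intro integral_distr[OF aff] borel_measurable_scaleR borel_measurable_const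
      borel_measurable_continuous_on_indicator) auto
  also have "\<dots> = (\<integral>w. c *\<^sub>R f (x + t *\<^sub>R w) \<partial>usm)"
    using \<open>t > 0\<close> by (intro integral_usm_cong) (auto simp: indicator_def dist_norm)
  finally have 1: "(LINT y:sphere x t|sphere_measure x t. f y) = c *\<^sub>R (\<integral>w. f (x + t *\<^sub>R w) \<partial>usm)" by simp
  have "emeasure (sphere_measure x t) (sphere x t) = ennreal c * emeasure usm (sphere 0 1 :: (real^'n) set)"
    unfolding sphere_measure_eq[OF \<open>t > 0\<close>] c_def[symmetric]
    by (simp add: emeasure_density_const emeasure_distr[OF aff] pre)
  then have "measure (sphere_measure x t) (sphere x t) = c * measure usm (sphere 0 1 :: (real^'n) set)"
    using c by (simp add: measure_def enn2real_mult)
  then show ?thesis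
    using 1 c \<open>t > 0\<close> by (simp add: spherical_mean_def)
qed

section \<open>Integrals over the sphere that depend on a parameter\<close>

text \<open>By compactness of the sphere, \<open>k x w\<close> is close to \<open>k x0 w\<close>
  uniformly in \<open>w\<close> once \<open>x\<close> is near \<open>x0\<close>, and the total mass
  is finite.\<close>

lemma continuous_on_usm_integral:
  fixes k :: "'a::topological_space \<Rightarrow> real^'n::finite \<Rightarrow> 'b::{banach,second_countable_topology}"
  assumes k: "continuous_on (X \<times> sphere 0 1) (\<lambda>(x, w). k x w)"
  shows "continuous_on X (\<lambda>x. \<integral>w. k x w \<partial>usm)"
proof -
  define m where "m = measure usm (sphere 0 1 :: (real^'n) set)"
  have m: "m > 0" unfolding m_def by (rule measure_usm_pos)
  have sl: "continuous_on (sphere 0 1) (k x)" if "x \<in> X" for x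
    using continuous_on_compose2[OF k, of "sphere 0 1" "\<lambda>w. (x, w)"] that
    by (simp add: continuous_on_Pair image_subset_iff)
  show ?thesis
    unfolding continuous_on_def tendsto_iff
  proof (intro ballI allI impI)
    fix x0 and e :: real assume x0: "x0 \<in> X" and "e > 0"
    then have "e / (2 * m) > 0" using m by simp
    from continuous_on_prod_compactE[OF k compact_sphere x0 this]
    obtain X0 where X0: "x0 \<in> X0" "open X0"
      "\<forall>x\<in>X0 \<inter> X. \<forall>w\<in>sphere 0 1. dist (k x w) (k x0 w) \<le> e / (2 * m)"
      unfolding split_conv .
    have "dist (\<integral>w. k x w \<partial>usm) (\<integral>w. k x0 w \<partial>usm) < e" if "x \<in> X0" "x \<in> X" for x
    proof -
      have "norm ((\<integral>w. k x w \<partial>usm) - (\<integral>w. k x0 w \<partial>usm)) = norm (\<integral>w. k x w - k x0 w \<partial>usm)"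
        using that x0 sl by (subst Bochner_Integration.integral_diff) (auto intro!: integrable_usm)
      also have "\<dots> \<le> (\<integral>w. norm (k x w - k x0 w) \<partial>usm)" by (rule integral_norm_bound)
      also have "\<dots> \<le> (\<integral>w. e / (2 * m) \<partial>(usm :: (real^'n) measure))"
        using X0 that x0 sl
        by (intro integral_mono integrable_usm) (auto simp: dist_norm intro!: continuous_intros)
      also have "\<dots> = e / 2" using m by (simp add: m_def)
      also have "\<dots> < e" using \<open>e > 0\<close> by simp
      finally show ?thesis by (simp add: dist_norm)
    qed
    then show "\<forall>\<^sub>F x in at x0 within X. dist (\<integral>w. k x w \<partial>usm) (\<integral>w. k x0 w \<partial>usm) < e"
      unfolding eventually_at_topological using X0(1,2) by (intro exI[of _ X0]) simp
  qed
qed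

text \<open>By the mean value inequality the error of the linearisation at \<open>s0\<close> is at
  most \<open>e / m\<close> times the increment, uniformly in \<open>w\<close>, because
  \<open>k' s\<close> is uniformly close to \<open>k' s0\<close> on the compact sphere. Integration
  over total mass \<open>m\<close> then gives \<open>e\<close>.\<close>

lemma has_vector_derivative_usm_integral:
  fixes k :: "real \<Rightarrow> real^'n::finite \<Rightarrow> 'b::{banach,second_countable_topology}"
  assumes J: "open J" "s0 \<in> J"
    and d: "\<And>s w. s \<in> J \<Longrightarrow> w \<in> sphere 0 1 \<Longrightarrow> ((\<lambda>s. k s w) has_vector_derivative k' s w) (at s)"
    and k': "continuous_on (J \<times> sphere 0 1) (\<lambda>(s, w). k' s w)"
    and k: "\<And>s. s \<in> J \<Longrightarrow> continuous_on (sphere 0 1) (k s)"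
  shows "((\<lambda>s. \<integral>w. k s w \<partial>usm) has_vector_derivative (\<integral>w. k' s0 w \<partial>usm)) (at s0)"
proof -
  define m where "m = measure usm (sphere 0 1 :: (real^'n) set)"
  have m: "m > 0" unfolding m_def by (rule measure_usm_pos)
  have sl: "continuous_on (sphere 0 1) (k' s)" if "s \<in> J" for s
    using continuous_on_compose2[OF k', of "sphere 0 1" "\<lambda>w. (s, w)"] that
    by (simp add: continuous_on_Pair image_subset_iff)
  show ?thesis
    unfolding has_vector_derivative_def has_derivative_at_alt
  proof (intro conjI allI impI)
    show "bounded_linear (\<lambda>x. x *\<^sub>R (\<integral>w. k' s0 w \<partial>usm))" by (rule bounded_linear_scaleR_left)
    fix e :: real assume "e > 0"
    then have "e / m > 0" using m by simp
    from continuous_on_prod_compactE[OF k' compact_sphere J(2) this]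
    obtain X0 where X0: "s0 \<in> X0" "open X0"
      "\<forall>s\<in>X0 \<inter> J. \<forall>w\<in>sphere 0 1. dist (k' s w) (k' s0 w) \<le> e / m"
      unfolding split_conv .
    then obtain r where r: "r > 0" "ball s0 r \<subseteq> X0 \<inter> J"
      using J by (meson IntI open_Int open_contains_ball)
    show "\<exists>d>0. \<forall>y. norm (y - s0) < d \<longrightarrow> norm ((\<integral>w. k y w \<partial>usm) - (\<integral>w. k s0 w \<partial>usm) -
        (y - s0) *\<^sub>R (\<integral>w. k' s0 w \<partial>usm)) \<le> e * norm (y - s0)"
    proof (intro exI conjI allI impI)
      fix y assume y: "norm (y - s0) < r"
      then have yb: "y \<in> ball s0 r" "s0 \<in> ball s0 r" using r by (auto simp: dist_norm)
      have yJ: "y \<in> J" using yb r by auto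
      have pt: "norm (k y w - k s0 w - (y - s0) *\<^sub>R k' s0 w) \<le> e / m * norm (y - s0)" if w: "w \<in> sphere 0 1" for w
      proof -
        \<comment> \<open>Removing the linear part leaves a function with derivative
          \<open>k' s w - k' s0 w\<close>, which is small near \<open>s0\<close>.\<close>
        define h where "h s = k s w - s *\<^sub>R k' s0 w" for s
        have "norm (h y - h s0) \<le> e / m * norm (y - s0)"
        proof (rule differentiable_bound[of "ball s0 r" h "\<lambda>s v. v *\<^sub>R (k' s w - k' s0 w)"])
          fix s assume s: "s \<in> ball s0 r"
          then have "s \<in> J" "s \<in> X0" using r by auto
          have "((\<lambda>s. k s w) has_vector_derivative k' s w) (at s within ball s0 r)"
            by (rule has_vector_derivative_at_within[OF d[OF \<open>s \<in> J\<close> w]])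
          moreover have "((\<lambda>s. s *\<^sub>R k' s0 w) has_vector_derivative k' s0 w) (at s within ball s0 r)"
            unfolding has_vector_derivative_def
            by (intro bounded_linear_imp_has_derivative bounded_linear_scaleR_left)
          ultimately have "(h has_vector_derivative (k' s w - k' s0 w)) (at s within ball s0 r)"
            unfolding h_def by (rule has_vector_derivative_diff)
          then show "(h has_derivative (\<lambda>v. v *\<^sub>R (k' s w - k' s0 w))) (at s within ball s0 r)"
            by (simp add: has_vector_derivative_def)
          have "norm (k' s w - k' s0 w) \<le> e / m" using X0 \<open>s \<in> J\<close> \<open>s \<in> X0\<close> w by (auto simp: dist_norm)
          then show "onorm (\<lambda>v. v *\<^sub>R (k' s w - k' s0 w)) \<le> e / m"
            by (intro onorm_le) (metis abs_ge_zero mult.commute mult_left_mono norm_scaleR real_norm_def)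
        qed (use yb in auto)
        then show ?thesis by (simp add: h_def algebra_simps)
      qed
      have "norm ((\<integral>w. k y w \<partial>usm) - (\<integral>w. k s0 w \<partial>usm) - (y - s0) *\<^sub>R (\<integral>w. k' s0 w \<partial>usm)) =
          norm (\<integral>w. k y w - k s0 w - (y - s0) *\<^sub>R k' s0 w \<partial>usm)"
        using yJ J k sl by (simp add: integrable_usm)
      also have "\<dots> \<le> (\<integral>w. norm (k y w - k s0 w - (y - s0) *\<^sub>R k' s0 w) \<partial>usm)" by (rule integral_norm_bound)
      also have "\<dots> \<le> (\<integral>w. e / m * norm (y - s0) \<partial>(usm :: (real^'n) measure))"
        using pt yJ J k sl by (intro integral_mono integrable_usm) (auto intro!: continuous_intros)
      also have "\<dots> = e * norm (y - s0)" using m by (simp add: m_def)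
      finally show "norm ((\<integral>w. k y w \<partial>usm) - (\<integral>w. k s0 w \<partial>usm) - (y - s0) *\<^sub>R (\<integral>w. k' s0 w \<partial>usm)) \<le>
          e * norm (y - s0)" .
    qed (rule r)
  qed
qed
text \<open>\<open>T\<close> maps the cone over the preimage of \<open>A\<close> onto the cone over
  \<open>A\<close> and changes volume by the factor \<bar>det T\<bar> = 1, so it preserves
  \<open>usm\<close>.\<close>

lemma integral_usm_orthogonal:
  fixes k :: "real^'n::{finite,wellorder} \<Rightarrow> real"
    and T :: "real^'n::{finite,wellorder} \<Rightarrow> real^'n::{finite,wellorder}"
  assumes T: "orthogonal_transformation T" and k: "continuous_on (sphere 0 1) k"
  shows "(\<integral>w. k (T w) \<partial>usm) = (\<integral>w. k w \<partial>usm)"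
proof -
  have norm: "norm (T x) = norm x" for x
    using T by (simp add: orthogonal_transformation)
  have T0: "T x = 0 \<longleftrightarrow> x = 0" for x using norm[of x] by (metis norm_eq_zero)
  have lin: "linear T" using T by (simp add: orthogonal_transformation)
  have sgnT: "sgn (T x) = T (sgn x)" for x
    using lin by (simp add: sgn_div_norm norm linear_scale)
  have cont: "continuous_on X T" for X using lin by (simp add: linear_continuous_on linear_conv_bounded_linear)
  have meas: "T \<in> usm \<rightarrow>\<^sub>M usm"
  proof -
    have "T \<in> usm \<rightarrow>\<^sub>M restrict_space borel (sphere 0 1)"
      by (intro measurable_restrict_space2 measurable_usm_continuous cont) (auto simp: norm)
    then show ?thesis by (simp cong: measurable_cong_sets add: sets_usm)
  qed
  have "distr usm usm T = usm"
  proof (rule measure_eqI)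
    fix A assume "A \<in> sets (distr usm usm T)"
    then have A: "A \<in> sets usm" by simp
    then have A': "A \<in> sets borel" "A \<subseteq> sphere 0 1"
      by (auto simp: sets_usm sets_restrict_space_iff)
    have TA: "T -` A \<inter> space usm \<in> sets usm" using measurable_sets[OF meas A] .
    then have TA': "T -` A \<inter> space usm \<in> sets borel" by (auto simp: sets_usm sets_restrict_space_iff)
    define C where "C A = {y \<in> cball 0 1 - {0 :: (real, 'n) vec}. sgn y \<in> A}" for A
    have CA: "C A \<in> sets lborel" if "A \<in> sets borel" for A
      using sphere_pullback_sets[OF that] by (simp add: C_def)
    have fin: "emeasure lborel (C A) < \<infinity>" if "A \<in> sets borel" for A
    proof -
      have "emeasure lborel (C A) \<le> emeasure lborel (cball 0 1 :: ((real, 'n) vec) set)"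
        by (intro emeasure_mono) (auto simp: C_def)
      also have "\<dots> < \<infinity>" by (rule emeasure_lborel_cball_finite)
      finally show ?thesis .
    qed
    have lm: "C A \<in> lmeasurable" if "A \<in> sets borel" for A
      using CA[OF that] fin[OF that] by (simp add: fmeasurable_def)
    have bij: "bij T" by (rule orthogonal_transformation_bij[OF T])
    have img: "T ` C (T -` A \<inter> space usm) = C A"
    proof
      show "T ` C (T -` A \<inter> space usm) \<subseteq> C A"
        by (auto simp: C_def sgnT norm T0)
      show "C A \<subseteq> T ` C (T -` A \<inter> space usm)"
      proof
        fix y assume y: "y \<in> C A"
        obtain z where z: "y = T z" using bij by (metis bij_pointE)
        then have "z \<in> C (T -` A \<inter> space usm)"
          using y by (auto simp: C_def z sgnT norm norm_sgn T0)
        then show "y \<in> T ` C (T -` A \<inter> space usm)" using z by blast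
      qed
    qed
    \<comment> \<open>The volume formula for linear images concerns Lebesgue measure; both cones are
      Borel sets of finite volume, so the equality passes to \<open>emeasure lborel\<close>.\<close>
    have "measure lebesgue (C A) = \<bar>det (matrix T)\<bar> * measure lebesgue (C (T -` A \<inter> space usm))"
      unfolding img[symmetric] by (intro measure_linear_image lin lm TA')
    then have "measure lborel (C A) = measure lborel (C (T -` A \<inter> space usm))"
      using CA[OF A'(1)] CA[OF TA'] orthogonal_transformation_det[OF T] by simp
    then have "emeasure lborel (C A) = emeasure lborel (C (T -` A \<inter> space usm))"
      using fin[OF A'(1)] fin[OF TA'] by (metis emeasure_eq_ennreal_measure infinity_ennreal_def less_irrefl)
    then show "emeasure (distr usm usm T) A = emeasure usm A"
      using emeasure_distr[OF meas A] emeasure_usm[OF A'] emeasure_usm[OF TA'] by (simp add: C_def)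
  qed simp
  then have "(\<integral>w. k w \<partial>usm) = (\<integral>w. k w \<partial>(distr usm usm T))" by simp
  also have "\<dots> = (\<integral>w. k (T w) \<partial>usm)"
    by (rule integral_distr[OF meas measurable_usm_continuous[OF k]])
  finally show ?thesis by simp
qed

section \<open>Partial derivatives of smooth functions\<close>

text \<open>\<open>partial_deriv\<close> refers to the derivative at parameter 0 only; this carries
  it to any other point of the line.\<close>

lemma has_vector_derivative_line_shift:
  fixes g :: "'a::real_vector \<Rightarrow> 'b::real_normed_vector"
  assumes "((\<lambda>s. g (y + s0 *\<^sub>R v + s *\<^sub>R v)) has_vector_derivative d) (at 0)"
  shows "((\<lambda>s. g (y + s *\<^sub>R v)) has_vector_derivative d) (at s0)"
proof -
  have "((\<lambda>s. s - s0) has_vector_derivative 1) (at s0)"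
    by (auto intro!: derivative_eq_intros)
  moreover have "((\<lambda>s. g (y + s0 *\<^sub>R v + s *\<^sub>R v)) has_vector_derivative d) (at (s0 - s0))"
    using assms by simp
  ultimately have "(((\<lambda>s. g (y + s0 *\<^sub>R v + s *\<^sub>R v)) \<circ> (\<lambda>s. s - s0)) has_vector_derivative 1 *\<^sub>R d) (at s0)"
    by (rule vector_diff_chain_at)
  moreover have "y + s0 *\<^sub>R v + (x - s0) *\<^sub>R v = y + x *\<^sub>R v" for x
    by (simp add: scaleR_diff_left)
  ultimately show ?thesis by (simp add: o_def)
qed

text \<open>The coordinates are changed one at a time. Each change is a one-dimensional increment,
  controlled by the mean value inequality because \<open>G i\<close> stays within \<open>e'\<close>
  of \<open>G i x\<close> near \<open>x\<close>.\<close>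

lemma has_derivative_of_continuous_partials:
  fixes g :: "real^'n::finite \<Rightarrow> real" and G :: "'n \<Rightarrow> real^'n \<Rightarrow> real"
  assumes U: "open U" "x \<in> U"
    and d: "\<And>i y. y \<in> U \<Longrightarrow> ((\<lambda>s. g (y + s *\<^sub>R axis i 1)) has_real_derivative G i y) (at 0)"
    and G: "\<And>i. continuous_on U (G i)"
  shows "(g has_derivative (\<lambda>h. \<Sum>i\<in>UNIV. h $ i * G i x)) (at x)"
  unfolding has_derivative_at_alt
proof (intro conjI allI impI)
  show "bounded_linear (\<lambda>h. \<Sum>i\<in>UNIV. h $ i * G i x)"
    by (intro bounded_linear_sum bounded_linear_mult_const bounded_linear_vec_nth)
  fix e :: real assume "e > 0"
  define e' where "e' = e / real CARD('n)"
  have "e' > 0" using \<open>e > 0\<close> by (simp add: e'_def)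
  have "\<forall>\<^sub>F y in nhds x. \<forall>i\<in>UNIV. y \<in> U \<and> dist (G i y) (G i x) < e'"
  proof (intro eventually_ball_finite ballI eventually_conj)
    fix i :: 'n
    show "\<forall>\<^sub>F y in nhds x. y \<in> U" using U by (rule eventually_nhds_in_open)
    have "isCont (G i) x" using G U by (simp add: continuous_on_eq_continuous_at)
    then show "\<forall>\<^sub>F y in nhds x. dist (G i y) (G i x) < e'"
      unfolding isCont_def tendsto_at_iff_tendsto_nhds by (rule tendstoD[OF _ \<open>e' > 0\<close>])
  qed auto
  then obtain r where r: "r > 0" "\<And>y i. dist y x < r \<Longrightarrow> y \<in> U \<and> dist (G i y) (G i x) < e'"
    unfolding eventually_nhds_metric by auto
  show "\<exists>d>0. \<forall>y. norm (y - x) < d \<longrightarrow> norm (g y - g x - (\<Sum>i\<in>UNIV. (y - x) $ i * G i x)) \<le> e * norm (y - x)"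
  proof (intro exI conjI allI impI)
    fix y assume y: "norm (y - x) < r"
    define h where "h = y - x"
    \<comment> \<open>\<open>pr I\<close> keeps the coordinates of \<open>h\<close> in
      \<open>I\<close>, so \<open>x + pr I\<close> moves from \<open>x\<close> to \<open>y\<close>
      as \<open>I\<close> grows from the empty set to all indices.\<close>
    define pr where "pr I = (\<Sum>i\<in>I. h $ i *\<^sub>R axis i (1::real))" for I
    have pr_nth: "pr I $ k = (if k \<in> I then h $ k else 0)" for I k
      unfolding pr_def by (simp add: axis_def if_distrib cong: if_cong)
    have "norm (g (x + pr I) - g x - (\<Sum>i\<in>I. h $ i * G i x)) \<le> (\<Sum>i\<in>I. e' * \<bar>h $ i\<bar>)" for I
      using finite[of I]
    proof (induction I rule: finite_induct)
      case empty
      then show ?case by (simp add: pr_def)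
    next
      case (insert i I)
      define p where "p s = g (x + pr I + s *\<^sub>R axis i 1) - s * G i x" for s
      have nb: "norm (pr I + s *\<^sub>R axis i 1) < r" if "\<bar>s\<bar> \<le> \<bar>h $ i\<bar>" for s
      proof -
        have "norm (pr I + s *\<^sub>R axis i 1) \<le> norm h"
          using that insert(2) by (intro norm_le_componentwise_cart) (auto simp: pr_nth axis_def)
        then show ?thesis using y by (simp add: h_def)
      qed
      have "norm (p (h $ i) - p 0) \<le> e' * norm (h $ i - 0)"
      proof (rule differentiable_bound[of "cball 0 \<bar>h $ i\<bar>" p
          "\<lambda>s. (*) (G i (x + pr I + s *\<^sub>R axis i 1) - G i x)"])
        fix s :: real assume s: "s \<in> cball 0 \<bar>h $ i\<bar>"
        then have "dist (x + pr I + s *\<^sub>R axis i 1) x < r"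
          using nb[of s] by (simp add: dist_norm add.assoc)
        note in_ball = r(2)[OF this]
        have "((\<lambda>u. g (x + pr I + u *\<^sub>R axis i 1)) has_real_derivative
            G i (x + pr I + s *\<^sub>R axis i 1)) (at s)"
          using has_vector_derivative_line_shift[of g "x + pr I" s "axis i 1"] d in_ball
          by (simp add: has_real_derivative_iff_has_vector_derivative)
        then have "(p has_real_derivative (G i (x + pr I + s *\<^sub>R axis i 1) - G i x)) (at s)"
          unfolding p_def by (auto intro!: derivative_eq_intros)
        then show "(p has_derivative ((*) (G i (x + pr I + s *\<^sub>R axis i 1) - G i x)))
            (at s within cball 0 \<bar>h $ i\<bar>)"
          by (simp add: has_field_derivative_def has_derivative_at_withinI)
        have "norm (G i (x + pr I + s *\<^sub>R axis i 1) - G i x) \<le> e'"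
          using in_ball[of i] by (simp add: dist_norm)
        then show "onorm ((*) (G i (x + pr I + s *\<^sub>R axis i 1) - G i x)) \<le> e'"
          by (intro onorm_le) (metis mult_right_mono norm_ge_zero norm_mult)
      qed auto
      then have 1: "norm (g (x + pr (insert i I)) - g (x + pr I) - h $ i * G i x) \<le> e' * \<bar>h $ i\<bar>"
        using insert(1,2) by (simp add: p_def pr_def algebra_simps)
      have "g (x + pr (insert i I)) - g x - (\<Sum>i\<in>insert i I. h $ i * G i x) =
          (g (x + pr (insert i I)) - g (x + pr I) - h $ i * G i x) + (g (x + pr I) - g x - (\<Sum>i\<in>I. h $ i * G i x))"
        using insert(1,2) by simp
      also have "norm \<dots> \<le> e' * \<bar>h $ i\<bar> + (\<Sum>i\<in>I. e' * \<bar>h $ i\<bar>)"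
        by (intro norm_triangle_mono 1 insert.IH)
      finally show ?case using insert(1,2) by simp
    qed
    from this[of UNIV] have "norm (g (x + pr UNIV) - g x - (\<Sum>i\<in>UNIV. h $ i * G i x)) \<le> (\<Sum>i\<in>UNIV. e' * \<bar>h $ i\<bar>)" .
    also have "\<dots> \<le> (\<Sum>i\<in>(UNIV::'n set). e' * norm h)"
      using \<open>e' > 0\<close> by (intro sum_mono mult_left_mono component_le_norm_cart) auto
    also have "\<dots> = e * norm h" by (simp add: e'_def)
    also have "x + pr UNIV = y" by (simp add: vec_eq_iff pr_nth h_def)
    finally show "norm (g y - g x - (\<Sum>i\<in>UNIV. (y - x) $ i * G i x)) \<le> e * norm (y - x)"
      by (simp add: h_def)
  qed (rule r)
qed

lemma has_real_derivative_grad: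
  fixes g :: "real^'n::finite \<Rightarrow> real"
  assumes "(g has_derivative (\<lambda>h. \<Sum>i\<in>UNIV. h $ i * G i (c s))) (at (c s))"
    and "(c has_vector_derivative c') (at s)"
  shows "((\<lambda>s. g (c s)) has_real_derivative (\<Sum>i\<in>UNIV. c' $ i * G i (c s))) (at s)"
proof -
  have "((\<lambda>s. g (c s)) has_derivative (\<lambda>v. \<Sum>i\<in>UNIV. (v *\<^sub>R c') $ i * G i (c s))) (at s)"
    using has_derivative_compose[OF assms(2)[unfolded has_vector_derivative_def] assms(1)] .
  also have "(\<lambda>v. \<Sum>i\<in>UNIV. (v *\<^sub>R c') $ i * G i (c s)) = (*) (\<Sum>i\<in>UNIV. c' $ i * G i (c s))"
    by (rule ext) (simp add: sum_distrib_left mult_ac)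
  finally show ?thesis
    by (simp add: has_field_derivative_def)
qed

lemma has_real_derivative_grad_line:
  fixes g :: "real^'n::finite \<Rightarrow> real"
  assumes "(g has_derivative (\<lambda>h. \<Sum>i\<in>UNIV. h $ i * G i (a + s *\<^sub>R v))) (at (a + s *\<^sub>R v))"
  shows "((\<lambda>s. g (a + s *\<^sub>R v)) has_real_derivative (\<Sum>i\<in>UNIV. v $ i * G i (a + s *\<^sub>R v))) (at s)"
  using assms by (rule has_real_derivative_grad) (auto intro!: derivative_eq_intros simp: has_vector_derivative_def)

lemma sum_axis_mult [simp]:
  fixes c :: "'n::finite \<Rightarrow> real"
  shows "(\<Sum>k\<in>UNIV. axis i (1::real) $ k * c k) = c i"
  by (simp add: axis_def if_distrib[of "\<lambda>x. x * _"] cong: if_cong)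

section \<open>Symmetry of second derivatives\<close>

text \<open>The mean value theorem is applied twice: in direction \<open>i\<close> to the increment
  of \<open>g\<close> in direction \<open>j\<close>, then in direction \<open>j\<close> to
  \<open>G i\<close>.\<close>

lemma second_difference_mean_value:
  fixes g :: "real^'n::finite \<Rightarrow> real"
  assumes g: "\<And>y. y \<in> ball x r \<Longrightarrow> (g has_derivative (\<lambda>h. \<Sum>i\<in>UNIV. h $ i * G i y)) (at y)"
    and G: "\<And>y. y \<in> ball x r \<Longrightarrow> (G i has_derivative (\<lambda>h. \<Sum>j\<in>UNIV. h $ j * H j y)) (at y)"
    and h: "0 < h" "2 * h < r"
  obtains p where "p \<in> ball x r"
    "g (x + h *\<^sub>R axis i 1 + h *\<^sub>R axis j 1) - g (x + h *\<^sub>R axis i 1) - g (x + h *\<^sub>R axis j 1) + g x = h * h * H j p"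
proof -
  have inb: "x + u *\<^sub>R axis i 1 + v *\<^sub>R axis j 1 \<in> ball x r" if "0 \<le> u" "u \<le> h" "0 \<le> v" "v \<le> h" for u v
  proof -
    have "norm (u *\<^sub>R axis i (1::real) + v *\<^sub>R axis j 1) \<le> u + v"
      using that by (intro norm_triangle_mono) auto
    also have "\<dots> < r" using that h by linarith
    also have "norm (u *\<^sub>R axis i (1::real) + v *\<^sub>R axis j 1) = dist x (x + (u *\<^sub>R axis i 1 + v *\<^sub>R axis j 1))"
      by (metis add_diff_cancel_left' dist_commute dist_norm)
    finally show ?thesis by (simp add: add.assoc)
  qed
  define \<phi> where "\<phi> u = g (x + h *\<^sub>R axis j 1 + u *\<^sub>R axis i 1) - g (x + u *\<^sub>R axis i 1)" for u
  have "\<exists>z>0. z < h \<and> \<phi> h - \<phi> 0 = (h - 0) * (G i (x + h *\<^sub>R axis j 1 + z *\<^sub>R axis i 1) - G i (x + z *\<^sub>R axis i 1))"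
  proof (rule MVT2)
    fix u assume u: "0 \<le> u" "u \<le> h"
    have "x + h *\<^sub>R axis j 1 + u *\<^sub>R axis i 1 \<in> ball x r" "x + u *\<^sub>R axis i 1 \<in> ball x r"
      using inb[of u h] inb[of u 0] u h by (auto simp: algebra_simps)
    from has_real_derivative_grad_line[where G = G and v = "axis i 1", OF g[OF this(1)]]
      has_real_derivative_grad_line[where G = G and v = "axis i 1", OF g[OF this(2)]]
    show "(\<phi> has_real_derivative (G i (x + h *\<^sub>R axis j 1 + u *\<^sub>R axis i 1) - G i (x + u *\<^sub>R axis i 1))) (at u)"
      unfolding \<phi>_def sum_axis_mult by (rule DERIV_diff)
  qed (rule h)
  then obtain z where z: "0 < z" "z < h"
    "\<phi> h - \<phi> 0 = h * (G i (x + h *\<^sub>R axis j 1 + z *\<^sub>R axis i 1) - G i (x + z *\<^sub>R axis i 1))" by auto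
  have "\<exists>v>0. v < h \<and> G i (x + z *\<^sub>R axis i 1 + h *\<^sub>R axis j 1) - G i (x + z *\<^sub>R axis i 1 + 0 *\<^sub>R axis j 1) =
      (h - 0) * H j (x + z *\<^sub>R axis i 1 + v *\<^sub>R axis j 1)"
  proof (rule MVT2)
    fix v assume v: "0 \<le> v" "v \<le> h"
    then have "x + z *\<^sub>R axis i 1 + v *\<^sub>R axis j 1 \<in> ball x r"
      using inb z by simp
    from has_real_derivative_grad_line[where G = H and v = "axis j 1", OF G[OF this]]
    show "((\<lambda>v. G i (x + z *\<^sub>R axis i 1 + v *\<^sub>R axis j 1)) has_real_derivative
        H j (x + z *\<^sub>R axis i 1 + v *\<^sub>R axis j 1)) (at v)"
      unfolding sum_axis_mult .
  qed (rule h)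
  then obtain v where v: "0 < v" "v < h"
    "G i (x + z *\<^sub>R axis i 1 + h *\<^sub>R axis j 1) - G i (x + z *\<^sub>R axis i 1) =
      h * H j (x + z *\<^sub>R axis i 1 + v *\<^sub>R axis j 1)" by auto
  have "g (x + h *\<^sub>R axis i 1 + h *\<^sub>R axis j 1) - g (x + h *\<^sub>R axis i 1) - g (x + h *\<^sub>R axis j 1) + g x = \<phi> h - \<phi> 0"
    by (simp add: \<phi>_def algebra_simps)
  also have "\<dots> = h * h * H j (x + z *\<^sub>R axis i 1 + v *\<^sub>R axis j 1)"
    using z(3) v(3) by (simp add: algebra_simps)
  finally show ?thesis using inb[of z v] z v by (intro that[of "x + z *\<^sub>R axis i 1 + v *\<^sub>R axis j 1"]) auto
qed

text \<open>The second difference is symmetric in \<open>i\<close> and \<open>j\<close>. Evaluating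
  it in both orders gives \<open>H j i p = H i j q\<close> at points \<open>p\<close>,
  \<open>q\<close> near \<open>x\<close>, and continuity at \<open>x\<close> does the rest.\<close>

lemma mixed_partials_eq:
  fixes g :: "real^'n::finite \<Rightarrow> real"
  assumes U: "open U" "x \<in> U"
    and g: "\<And>y. y \<in> U \<Longrightarrow> (g has_derivative (\<lambda>h. \<Sum>i\<in>UNIV. h $ i * G i y)) (at y)"
    and G: "\<And>i y. y \<in> U \<Longrightarrow> (G i has_derivative (\<lambda>h. \<Sum>j\<in>UNIV. h $ j * H j i y)) (at y)"
    and H: "\<And>i j. continuous_on U (H j i)"
  shows "H j i x = H i j x"
proof -
  have "\<bar>H j i x - H i j x\<bar> \<le> e" if "e > 0" for e
  proof -
    have ev: "\<forall>\<^sub>F y in nhds x. dist (H j i y) (H j i x) < e / 2" for i j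
    proof -
      have "isCont (H j i) x" using H U by (simp add: continuous_on_eq_continuous_at)
      then show ?thesis
        unfolding isCont_def tendsto_at_iff_tendsto_nhds by (rule tendstoD) (use \<open>e > 0\<close> in simp)
    qed
    have "\<forall>\<^sub>F y in nhds x. y \<in> U \<and> dist (H j i y) (H j i x) < e / 2 \<and> dist (H i j y) (H i j x) < e / 2"
      by (intro eventually_conj ev eventually_nhds_in_open U)
    then obtain r where r: "r > 0" "\<And>y. dist y x < r \<Longrightarrow>
        y \<in> U \<and> dist (H j i y) (H j i x) < e / 2 \<and> dist (H i j y) (H i j x) < e / 2"
      unfolding eventually_nhds_metric by auto
    then have rU: "y \<in> U" if "y \<in> ball x r" for y using that by (auto simp: dist_commute)
    have h: "0 < r / 3" "2 * (r / 3) < r" using r by auto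
    obtain p where p: "p \<in> ball x r"
      "g (x + (r/3) *\<^sub>R axis i 1 + (r/3) *\<^sub>R axis j 1) - g (x + (r/3) *\<^sub>R axis i 1) - g (x + (r/3) *\<^sub>R axis j 1) + g x
        = r/3 * (r/3) * H j i p"
      by (rule second_difference_mean_value[OF g[OF rU] G[OF rU] h])
    obtain q where q: "q \<in> ball x r"
      "g (x + (r/3) *\<^sub>R axis j 1 + (r/3) *\<^sub>R axis i 1) - g (x + (r/3) *\<^sub>R axis j 1) - g (x + (r/3) *\<^sub>R axis i 1) + g x
        = r/3 * (r/3) * H i j q"
      by (rule second_difference_mean_value[OF g[OF rU] G[OF rU] h])
    have swap: "x + (r/3) *\<^sub>R axis i 1 + (r/3) *\<^sub>R axis j 1 = x + (r/3) *\<^sub>R axis j 1 + (r/3) *\<^sub>R axis i (1::real)"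
      by (simp add: algebra_simps)
    have "r/3 * (r/3) * H j i p = r/3 * (r/3) * H i j q"
      unfolding p(2)[symmetric] q(2)[symmetric] swap by (rule arg_cong2[where f = "(+)"]) auto
    then have "H j i p = H i j q" using r by simp
    moreover have "dist (H j i p) (H j i x) < e / 2" "dist (H i j q) (H i j x) < e / 2"
      using r(2)[of p] r(2)[of q] p(1) q(1) by (simp_all add: dist_commute)
    ultimately show ?thesis unfolding dist_real_def by linarith
  qed
  from field_le_epsilon[of "\<bar>H j i x - H i j x\<bar>" 0, simplified, OF this] show ?thesis by simp
qed

section \<open>Families of all iterated partial derivatives\<close>

text \<open>\<open>F is\<close> is the iterated partial derivative of \<open>F []\<close> along the indices in \<open>is\<close>, the head of the
  list being differentiated last.\<close>

definition jet :: "(real^'n::finite) set \<Rightarrow> ('n list \<Rightarrow> real^'n \<Rightarrow> real) \<Rightarrow> bool"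
  where "jet U F \<longleftrightarrow> open U \<and>
    (\<forall>is. \<forall>x\<in>U. (F is has_derivative (\<lambda>h. \<Sum>i\<in>UNIV. h $ i * F (i # is) x)) (at x))"

lemma jet_open: "jet U F \<Longrightarrow> open U"
  by (simp add: jet_def)

lemma jet_has_derivative:
  "jet U F \<Longrightarrow> x \<in> U \<Longrightarrow> (F is has_derivative (\<lambda>h. \<Sum>i\<in>UNIV. h $ i * F (i # is) x)) (at x)"
  by (simp add: jet_def)

lemma jet_continuous_on: "jet U F \<Longrightarrow> continuous_on U (F is)"
  by (rule continuous_at_imp_continuous_on) (blast intro: has_derivative_continuous jet_has_derivative)

lemma jet_commute:
  assumes "jet U F" "x \<in> U"
  shows "F (i # j # is) x = F (j # i # is) x"
proof (rule mixed_partials_eq[where g = "F is" and G = "\<lambda>i. F (i # is)" and H = "\<lambda>i j. F (i # j # is)"])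
  show "open U" "x \<in> U" using assms by (simp_all add: jet_open)
qed (use assms jet_has_derivative jet_continuous_on in blast)+

text \<open>Every derivative of \<open>F []\<close> has a jet of its own, so a result about the head
  function of a jet holds for all its derivatives.\<close>

lemma jet_append: "jet U F \<Longrightarrow> jet U (\<lambda>is. F (is @ js))"
  by (simp add: jet_def)

section \<open>Iterated partial derivatives of smooth functions\<close>

definition pds :: "'n list \<Rightarrow> (real^'n::finite \<Rightarrow> 'b::real_normed_vector) \<Rightarrow> real^'n \<Rightarrow> 'b"
  where "pds is f = foldr partial_deriv is f"

lemma pds_simps [simp]:
  "pds [] f = f" "pds (i # is) f = partial_deriv i (pds is f)"
  by (simp_all add: pds_def)

lemma eventually_line_in_open:
  fixes x v :: "'a::real_normed_vector"
  assumes "open U" "x \<in> U"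
  shows "\<forall>\<^sub>F s in nhds (0::real). x + s *\<^sub>R v \<in> U"
proof -
  have "open ((\<lambda>s::real. x + s *\<^sub>R v) -` U)"
    by (intro open_vimage assms continuous_intros)
  then show ?thesis
    using assms eventually_nhds_in_open[of "(\<lambda>s::real. x + s *\<^sub>R v) -` U" 0] by simp
qed

lemma partial_deriv_cong:
  fixes f g :: "real^'n::finite \<Rightarrow> 'b::real_normed_vector"
  assumes "open U" "x \<in> U" "\<And>y. y \<in> U \<Longrightarrow> f y = g y"
  shows "partial_deriv i f x = partial_deriv i g x"
proof -
  have "\<forall>\<^sub>F s in nhds (0::real). f (x + s *\<^sub>R axis i 1) = g (x + s *\<^sub>R axis i 1)"
    using eventually_line_in_open[OF assms(1,2)] by eventually_elim (rule assms(3))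
  then show ?thesis
    unfolding partial_deriv_def by (intro vector_derivative_cong_eq) auto
qed

lemma Cinf_on_continuous_on: "Cinf_on U f \<Longrightarrow> continuous_on U f"
  using Ck_on.simps(1) unfolding Cinf_on_def by blast

lemma Cinf_on_partial_deriv: "Cinf_on U f \<Longrightarrow> Cinf_on U (partial_deriv i f)"
  unfolding Cinf_on_def by (metis Ck_on.simps(2))

lemma Cinf_on_pds: "Cinf_on U f \<Longrightarrow> Cinf_on U (pds is f)"
  by (induction "is") (simp_all add: Cinf_on_partial_deriv)

lemma Cinf_on_has_vector_derivative:
  assumes "Cinf_on U f" "x \<in> U"
  shows "((\<lambda>s. f (x + s *\<^sub>R axis i 1)) has_vector_derivative partial_deriv i f x) (at 0)"
proof -
  have "Ck_on (Suc 0) U f" using assms(1) unfolding Cinf_on_def by blast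
  then have "(\<lambda>s. f (x + s *\<^sub>R axis i 1)) differentiable (at 0)"
    using assms(2) by simp
  then show ?thesis
    unfolding partial_deriv_def by (simp add: vector_derivative_works)
qed

text \<open>Links the coordinatewise notion \<open>Cinf_on\<close> to total derivatives: the partial
  derivatives are continuous. The inner product with \<open>b\<close> reduces vector values to real
  ones.\<close>

lemma Cinf_on_jet:
  fixes f :: "real^'n::finite \<Rightarrow> 'b::real_inner"
  assumes U: "open U" and f: "Cinf_on U f"
  shows "jet U (\<lambda>is x. pds is f x \<bullet> b)"
  unfolding jet_def
proof (intro conjI allI ballI U)
  fix "is" :: "'n list" and x assume "x \<in> U"
  show "((\<lambda>x. pds is f x \<bullet> b) has_derivative (\<lambda>h. \<Sum>i\<in>UNIV. h $ i * (pds (i # is) f x \<bullet> b))) (at x)"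
  proof (rule has_derivative_of_continuous_partials[OF U \<open>x \<in> U\<close>])
    fix i y assume "y \<in> U"
    then have "((\<lambda>s. pds is f (y + s *\<^sub>R axis i 1)) has_vector_derivative pds (i # is) f y) (at 0)"
      using Cinf_on_has_vector_derivative[OF Cinf_on_pds[OF f]] by simp
    from bounded_linear.has_vector_derivative[OF bounded_linear_inner_left this]
    show "((\<lambda>s. pds is f (y + s *\<^sub>R axis i 1) \<bullet> b) has_real_derivative pds (i # is) f y \<bullet> b) (at 0)"
      by (simp only: has_real_derivative_iff_has_vector_derivative)
  next
    fix i
    show "continuous_on U (\<lambda>x. pds (i # is) f x \<bullet> b)"
      by (intro continuous_on_inner continuous_on_const Cinf_on_continuous_on[OF Cinf_on_pds[OF f]])
  qed
qed

text \<open>Swapping the two outermost derivatives suffices: an index deep in the list is brought to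
  the front step by step. The identities must hold on all of \<open>U\<close>, since
  \<open>partial_deriv_cong\<close> needs them near the point.\<close>

lemma pds_perm:
  fixes f :: "real^'n::finite \<Rightarrow> 'b::euclidean_space"
  assumes U: "open U" and f: "Cinf_on U f" and "mset is = mset js" "x \<in> U"
  shows "pds is f x = pds js f x"
proof -
  have swap: "pds (i # j # is) f x = pds (j # i # is) f x" if "x \<in> U" for i j x "is"
  proof (rule euclidean_eqI)
    fix b :: 'b
    show "pds (i # j # is) f x \<bullet> b = pds (j # i # is) f x \<bullet> b"
      using jet_commute[OF Cinf_on_jet[OF U f, of b] that, of i j "is"] .
  qed
  have move: "x \<in> U \<Longrightarrow> pds (a @ i # b) f x = pds (i # a @ b) f x" for a b i x
  proof (induction a arbitrary: x)
    case (Cons c a)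
    have "partial_deriv c (pds (a @ i # b) f) x = partial_deriv c (pds (i # a @ b) f) x"
      by (rule partial_deriv_cong[OF U Cons.prems Cons.IH])
    also have "\<dots> = pds (i # c # a @ b) f x"
      using swap[OF Cons.prems, of c i "a @ b"] by simp
    finally show ?case by simp
  qed simp
  show ?thesis using assms(3,4)
  proof (induction "is" arbitrary: js x)
    case (Cons i "is")
    then have "i \<in> set js" by (metis list.set_intros(1) mset_eq_setD)
    then obtain a b where js: "js = a @ i # b" by (meson split_list)
    then have "mset is = mset (a @ b)" using Cons.prems by simp
    then have "partial_deriv i (pds is f) x = partial_deriv i (pds (a @ b) f) x"
      by (intro partial_deriv_cong[OF U Cons.prems(2)] Cons.IH)
    then show ?case using move[OF Cons.prems(2), of a i b] js by simp
  qed simp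
qed

text \<open>\<open>multi_deriv\<close> takes derivatives in one fixed order, so an arbitrary list of
  indices is matched only up to rearrangement: \<alpha> counts the occurrences and \<open>js\<close>
  is the list sorted into blocks.\<close>

lemma ex_multi_deriv_pds:
  fixes "is" :: "'n::{finite,wellorder} list"
  shows "\<exists>\<alpha> js. mset js = mset is \<and>
    (\<forall>g :: real^'n::{finite,wellorder} \<Rightarrow> 'b::real_normed_vector. multi_deriv \<alpha> g = pds js g)"
proof -
  define \<alpha> where "\<alpha> i = count (mset is) i" for i
  define blocks where "blocks l = concat (map (\<lambda>i. replicate (\<alpha> i) i) l)" for l :: "'n list"
  have "count (mset (blocks l)) i = (if i \<in> set l then \<alpha> i else 0)" if "distinct l" for l i
    using that
  proof (induction l)
    case (Cons a l)
    have "count (mset (blocks (a # l))) i = count (replicate_mset (\<alpha> a) a) i + count (mset (blocks l)) i"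
      by (simp add: blocks_def)
    then show ?case using Cons by auto
  qed (simp add: blocks_def)
  then have count: "mset (blocks (sorted_list_of_set UNIV)) = mset is"
    by (intro multiset_eqI) (simp add: \<alpha>_def)
  have pow: "(partial_deriv i ^^ k) g = pds (replicate k i) g" for i k and g :: "(real, 'n) vec \<Rightarrow> 'b"
    by (induction k) (simp_all add: pds_def)
  have "foldr (\<lambda>i. partial_deriv i ^^ \<alpha> i) l g = pds (blocks l) g" for l and g :: "(real, 'n) vec \<Rightarrow> 'b"
  proof (induction l)
    case (Cons a l)
    then show ?case by (simp add: pow blocks_def pds_def[of "_ @ _"] pds_def[of "concat _"])
  qed (simp add: blocks_def)
  then show ?thesis
    using count unfolding multi_deriv_def by blast
qed

section \<open>Derivatives of the spherical mean in its centre\<close>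

text \<open>Differentiation under the integral sign is possible since all spheres involved stay in
  the ball of radius \<open>R + \<epsilon>\<close>.\<close>

lemma pds_spherical_mean:
  fixes f :: "real^'n::finite \<Rightarrow> 'b::euclidean_space"
  assumes f: "Cinf_on (ball 0 (R + \<epsilon>)) f" and t: "0 \<le> t" "t \<le> R" and x: "x \<in> ball 0 \<epsilon>"
  shows "pds is (\<lambda>x. spherical_mean f x t) x =
    (1 / measure usm (sphere 0 1 :: (real^'n) set)) *\<^sub>R (\<integral>w. pds is f (x + t *\<^sub>R w) \<partial>usm)"
  using x
proof (induction "is" arbitrary: x)
  case Nil
  show ?case
  proof (cases "t = 0")
    \<comment> \<open>For \<open>t = 0\<close> the integrand is constant in \<open>w\<close>, and
      its integral divided by the total mass agrees with the value \<open>f x\<close> fixed by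
      definition.\<close>
    case True
    then show ?thesis
      using measure_usm_pos[where 'n='n] by (simp add: spherical_mean_def)
  next
    case False
    have "sphere x t \<subseteq> ball 0 (R + \<epsilon>)"
    proof
      fix y assume "y \<in> sphere x t"
      then have "norm y \<le> norm x + t" using norm_triangle_ineq[of x "y - x"] by (simp add: dist_norm norm_minus_commute)
      then show "y \<in> ball 0 (R + \<epsilon>)" using t Nil by simp
    qed
    then have "continuous_on (sphere x t) f"
      using Cinf_on_continuous_on[OF f] continuous_on_subset by blast
    then show ?thesis using False t spherical_mean_eq_usm[of t x f] by simp
  qed
next
  case (Cons i "is")
  let ?c = "1 / measure usm (sphere 0 1 :: (real^'n) set)"
  let ?g = "pds is f"
  have inU: "x + t *\<^sub>R w \<in> ball 0 (R + \<epsilon>)" if "norm x < \<epsilon>" "norm w = 1" for x w :: "real^'n"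
    using norm_triangle_ineq[of x "t *\<^sub>R w"] that t by simp
  have opn: "open {s. x + s *\<^sub>R axis i 1 \<in> ball 0 \<epsilon>}"
    using open_vimage[of "ball 0 \<epsilon>" "\<lambda>s::real. x + s *\<^sub>R axis i 1"] by (simp add: vimage_def continuous_intros del: mem_ball)
  have line: "x + s *\<^sub>R axis i 1 + t *\<^sub>R w \<in> ball 0 (R + \<epsilon>)"
    if "s \<in> {s. x + s *\<^sub>R axis i 1 \<in> ball 0 \<epsilon>}" "w \<in> sphere 0 1" for s w
    using that by (intro inU) auto
  have "((\<lambda>s. \<integral>w. ?g (x + s *\<^sub>R axis i 1 + t *\<^sub>R w) \<partial>usm) has_vector_derivative
      (\<integral>w. partial_deriv i ?g (x + 0 *\<^sub>R axis i 1 + t *\<^sub>R w) \<partial>usm)) (at 0)"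
  proof (rule has_vector_derivative_usm_integral[OF opn])
    show "0 \<in> {s. x + s *\<^sub>R axis i 1 \<in> ball 0 \<epsilon>}" using Cons.prems by simp
    fix s :: real and w :: "real^'n"
    assume s: "s \<in> {s. x + s *\<^sub>R axis i 1 \<in> ball 0 \<epsilon>}" and "w \<in> sphere 0 1"
    from Cinf_on_has_vector_derivative[OF Cinf_on_pds[OF f] line[OF this], of "is" i]
    show "((\<lambda>s. ?g (x + s *\<^sub>R axis i 1 + t *\<^sub>R w)) has_vector_derivative
        partial_deriv i ?g (x + s *\<^sub>R axis i 1 + t *\<^sub>R w)) (at s)"
      using has_vector_derivative_line_shift[of ?g "x + t *\<^sub>R w" s "axis i 1"]
      by (simp add: add_ac)
  next
    show "continuous_on ({s. x + s *\<^sub>R axis i 1 \<in> ball 0 \<epsilon>} \<times> sphere 0 1)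
      (\<lambda>(s, w). partial_deriv i ?g (x + s *\<^sub>R axis i 1 + t *\<^sub>R w))"
      unfolding split_beta using line
      by (intro continuous_on_compose2[OF Cinf_on_continuous_on[OF Cinf_on_partial_deriv[OF Cinf_on_pds[OF f]]]]
          continuous_intros) auto
  next
    fix s :: real assume "s \<in> {s. x + s *\<^sub>R axis i 1 \<in> ball 0 \<epsilon>}"
    then show "continuous_on (sphere 0 1) (\<lambda>w. ?g (x + s *\<^sub>R axis i 1 + t *\<^sub>R w))"
      using line
      by (intro continuous_on_compose2[OF Cinf_on_continuous_on[OF Cinf_on_pds[OF f]]] continuous_intros) auto
  qed
  from has_vector_derivative_scaleR[OF DERIV_const this, of ?c]
  have "((\<lambda>s. ?c *\<^sub>R (\<integral>w. ?g (x + s *\<^sub>R axis i 1 + t *\<^sub>R w) \<partial>usm)) has_vector_derivative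
      ?c *\<^sub>R (\<integral>w. partial_deriv i ?g (x + t *\<^sub>R w) \<partial>usm)) (at 0)"
    by simp
  then have "partial_deriv i (\<lambda>x. ?c *\<^sub>R (\<integral>w. ?g (x + t *\<^sub>R w) \<partial>usm)) x =
      ?c *\<^sub>R (\<integral>w. partial_deriv i ?g (x + t *\<^sub>R w) \<partial>usm)"
    unfolding partial_deriv_def[of i "\<lambda>x. ?c *\<^sub>R (\<integral>w. ?g (x + t *\<^sub>R w) \<partial>usm)"] by (rule vector_derivative_at)
  moreover have "partial_deriv i (pds is (\<lambda>x. spherical_mean f x t)) x =
      partial_deriv i (\<lambda>x. ?c *\<^sub>R (\<integral>w. ?g (x + t *\<^sub>R w) \<partial>usm)) x"
    using Cons by (intro partial_deriv_cong[of "ball 0 \<epsilon>"]) auto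
  ultimately show ?case by simp
qed

section \<open>The tangential divergence theorem\<close>

text \<open>Serves two purposes: a constant \<open>v\<close> differentiates in the centre of the
  sphere, while a constant \<open>a\<close> with \<open>v w = w\<close> differentiates in the
  radius.\<close>

lemma usm_integral_line_derivative:
  fixes g p :: "real^'n::finite \<Rightarrow> real" and a v :: "real^'n \<Rightarrow> real^'n"
  assumes g: "\<And>y. y \<in> U \<Longrightarrow> (g has_derivative (\<lambda>h. \<Sum>i\<in>UNIV. h $ i * G i y)) (at y)"
    and G: "\<And>i. continuous_on U (G i)"
    and J: "open J" "s0 \<in> J" "\<And>s w. s \<in> J \<Longrightarrow> w \<in> sphere 0 1 \<Longrightarrow> a w + s *\<^sub>R v w \<in> U"
    and p: "continuous_on (sphere 0 1) p" and a: "continuous_on (sphere 0 1) a"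
    and v: "continuous_on (sphere 0 1) v"
  shows "((\<lambda>s. \<integral>w. p w * g (a w + s *\<^sub>R v w) \<partial>usm) has_real_derivative
    (\<integral>w. p w * (\<Sum>i\<in>UNIV. v w $ i * G i (a w + s0 *\<^sub>R v w)) \<partial>usm)) (at s0)"
  unfolding has_real_derivative_iff_has_vector_derivative
proof (rule has_vector_derivative_usm_integral[OF J(1,2)])
  fix s :: real and w :: "real^'n" assume "s \<in> J" "w \<in> sphere 0 1"
  from DERIV_cmult[OF has_real_derivative_grad_line[where G = G, OF g[OF J(3)[OF this]]], of "p w"]
  show "((\<lambda>s. p w * g (a w + s *\<^sub>R v w)) has_vector_derivative
      p w * (\<Sum>i\<in>UNIV. v w $ i * G i (a w + s *\<^sub>R v w))) (at s)"
    by (simp only: has_real_derivative_iff_has_vector_derivative)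
next
  note snd_cont = continuous_on_compose2[OF _ continuous_on_snd[OF continuous_on_id]]
  have line: "continuous_on (J \<times> sphere 0 1) (\<lambda>z. a (snd z) + fst z *\<^sub>R v (snd z))"
    by (intro continuous_intros snd_cont[OF a] snd_cont[OF v]) auto
  show "continuous_on (J \<times> sphere 0 1) (\<lambda>(s, w). p w * (\<Sum>i\<in>UNIV. v w $ i * G i (a w + s *\<^sub>R v w)))"
    unfolding split_beta using J(3)
    by (intro continuous_intros snd_cont[OF p] snd_cont[OF v] continuous_on_compose2[OF G line]) auto
next
  have gU: "continuous_on U g"
    by (rule continuous_at_imp_continuous_on) (blast intro: has_derivative_continuous g)
  fix s assume "s \<in> J"
  then show "continuous_on (sphere 0 1) (\<lambda>w. p w * g (a w + s *\<^sub>R v w))"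
    using J(3) by (intro continuous_intros p continuous_on_compose2[OF gU] a v) auto
qed

lemma usm_integral_translate_derivative:
  fixes g p :: "real^'n::finite \<Rightarrow> real"
  assumes g: "\<And>y. y \<in> U \<Longrightarrow> (g has_derivative (\<lambda>h. \<Sum>i\<in>UNIV. h $ i * G i y)) (at y)"
    and G: "\<And>i. continuous_on U (G i)"
    and V: "open V" "x \<in> V" "\<And>y w. y \<in> V \<Longrightarrow> w \<in> sphere 0 1 \<Longrightarrow> y + t *\<^sub>R w \<in> U"
    and p: "continuous_on (sphere 0 1) p"
  shows "((\<lambda>x. \<integral>w. p w * g (x + t *\<^sub>R w) \<partial>usm) has_derivative
    (\<lambda>h. \<Sum>i\<in>UNIV. h $ i * (\<integral>w. p w * G i (x + t *\<^sub>R w) \<partial>usm))) (at x)"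
proof (rule has_derivative_of_continuous_partials[OF V(1,2)])
  fix i y assume y: "y \<in> V"
  let ?J = "(\<lambda>s::real. y + s *\<^sub>R axis i 1) -` V"
  have "((\<lambda>s. \<integral>w. p w * g ((y + t *\<^sub>R w) + s *\<^sub>R axis i 1) \<partial>usm) has_real_derivative
    (\<integral>w. p w * (\<Sum>k\<in>UNIV. axis i 1 $ k * G k ((y + t *\<^sub>R w) + 0 *\<^sub>R axis i 1)) \<partial>usm)) (at 0)"
  proof (rule usm_integral_line_derivative[where J = ?J, OF g G])
    show "open ?J" by (intro open_vimage V continuous_intros)
    show "0 \<in> ?J" using y by simp
    fix s :: real and w :: "real^'n" assume "s \<in> ?J" "w \<in> sphere 0 1"
    then show "y + t *\<^sub>R w + s *\<^sub>R axis i 1 \<in> U"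
      using V(3)[of "y + s *\<^sub>R axis i 1" w] by (simp add: add_ac)
  qed (auto intro!: continuous_intros p)
  then show "((\<lambda>s. \<integral>w. p w * g (y + s *\<^sub>R axis i 1 + t *\<^sub>R w) \<partial>usm) has_real_derivative
      (\<integral>w. p w * G i (y + t *\<^sub>R w) \<partial>usm)) (at 0)"
    unfolding sum_axis_mult by (simp add: add_ac)
next
  fix i
  show "continuous_on V (\<lambda>x. \<integral>w. p w * G i (x + t *\<^sub>R w) \<partial>usm)"
    unfolding split_beta using V(3)
    by (intro continuous_on_usm_integral)
      (auto simp: split_beta intro!: continuous_intros continuous_on_compose2[OF G]
        continuous_on_compose2[OF p continuous_on_snd[OF continuous_on_id]])
qed

section \<open>Rotations in a coordinate plane and tangential integration by parts\<close>

text \<open>For \<open>i \<noteq> j\<close> this is the rotation by the angle \<theta> in the plane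
  of the coordinates \<open>i\<close> and \<open>j\<close>. Written as the identity plus a
  correction along two axes, it needs no case distinction on components.\<close>

definition rot :: "'n \<Rightarrow> 'n \<Rightarrow> real \<Rightarrow> real^'n::finite \<Rightarrow> real^'n"
  where "rot i j \<theta> y = y + ((cos \<theta> - 1) * y $ i - sin \<theta> * y $ j) *\<^sub>R axis i 1 +
    (sin \<theta> * y $ i + (cos \<theta> - 1) * y $ j) *\<^sub>R axis j 1"

definition drot :: "'n \<Rightarrow> 'n \<Rightarrow> real \<Rightarrow> real^'n::finite \<Rightarrow> real^'n"
  where "drot i j \<theta> y = (- sin \<theta> * y $ i - cos \<theta> * y $ j) *\<^sub>R axis i 1 +
    (cos \<theta> * y $ i - sin \<theta> * y $ j) *\<^sub>R axis j 1"

lemma rot_has_vector_derivative: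
  "((\<lambda>\<theta>. rot i j \<theta> y) has_vector_derivative drot i j \<theta> y) (at \<theta>)"
proof -
  have "((\<lambda>\<theta>. (cos \<theta> - 1) * y $ i - sin \<theta> * y $ j) has_real_derivative - sin \<theta> * y $ i - cos \<theta> * y $ j) (at \<theta>)"
    "((\<lambda>\<theta>. sin \<theta> * y $ i + (cos \<theta> - 1) * y $ j) has_real_derivative cos \<theta> * y $ i - sin \<theta> * y $ j) (at \<theta>)"
    by (auto intro!: derivative_eq_intros)
  from this[THEN has_vector_derivative_scaleR[OF _ has_vector_derivative_const]]
  show ?thesis
    unfolding rot_def drot_def
    by (auto intro!: has_vector_derivative_add_const[THEN iffD2] has_vector_derivative_add
      simp: add.assoc has_vector_derivative_add_const add.commute[of y])
qed

lemma axis_nth_neq: "i \<noteq> j \<Longrightarrow> axis i (1::real) $ j = 0"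
  by (simp add: axis_def)

lemma orthogonal_transformation_rot:
  assumes "i \<noteq> j"
  shows "orthogonal_transformation (rot i j \<theta>)"
  unfolding orthogonal_transformation
proof (intro conjI allI)
  show "linear (rot i j \<theta>)"
    by (rule linearI) (simp_all add: rot_def algebra_simps)
  fix y :: "real^'a"
  define a where "a = (cos \<theta> - 1) * y $ i - sin \<theta> * y $ j"
  define b where "b = sin \<theta> * y $ i + (cos \<theta> - 1) * y $ j"
  have "rot i j \<theta> y \<bullet> rot i j \<theta> y = y \<bullet> y + 2 * a * y $ i + 2 * b * y $ j + a\<^sup>2 + b\<^sup>2"
    unfolding rot_def a_def[symmetric] b_def[symmetric]
    using assms axis_nth_neq[of i j] axis_nth_neq[of j i]
    by (simp add: inner_add_left inner_add_right inner_axis inner_axis' power2_eq_square algebra_simps)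
  moreover have "2 * a * y $ i + 2 * b * y $ j + a\<^sup>2 + b\<^sup>2 = 0"
    using sin_cos_squared_add[of \<theta>] unfolding a_def b_def by algebra
  ultimately have "rot i j \<theta> y \<bullet> rot i j \<theta> y = y \<bullet> y" by linarith
  then show "norm (rot i j \<theta> y) = norm y" by (simp add: norm_eq_sqrt_inner)
qed

text \<open>The integral of \<open>w \<mapsto> g (s w) w\<^sub>j\<close> does not change when the argument is rotated; this is the
  derivative of that statement at angle \<open>0\<close>. Summing over \<open>j \<noteq> i\<close> gives the divergence theorem on the
  sphere without any appeal to polar coordinates.\<close>

lemma usm_tangential_pair:
  fixes g :: "real^'n::{finite,wellorder} \<Rightarrow> real"
  assumes g: "\<And>y. y \<in> ball 0 \<rho> \<Longrightarrow> (g has_derivative (\<lambda>h. \<Sum>i\<in>UNIV. h $ i * G i y)) (at y)"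
    and G: "\<And>i. continuous_on (ball 0 \<rho>) (G i)"
    and s: "0 < s" "s < \<rho>" and ij: "i \<noteq> j"
  shows "(\<integral>w. s * (w $ i * G j (s *\<^sub>R w) - w $ j * G i (s *\<^sub>R w)) * w $ j + g (s *\<^sub>R w) * w $ i \<partial>usm) = 0"
proof -
  have norm_rot: "norm (rot i j \<theta> y) = norm y" for \<theta> and y :: "(real, 'n) vec"
    using orthogonal_transformation_rot[OF ij, of \<theta>] by (simp add: orthogonal_transformation)
  have inb: "s *\<^sub>R rot i j \<theta> w \<in> ball 0 \<rho>" if "w \<in> sphere 0 1" for \<theta> and w :: "(real, 'n) vec"
    using that s by (simp add: norm_rot)
  have gb: "continuous_on (ball 0 \<rho>) g"
    by (rule continuous_at_imp_continuous_on) (blast intro: has_derivative_continuous g)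
  define k where "k \<theta> w = g (s *\<^sub>R rot i j \<theta> w) * rot i j \<theta> w $ j" for \<theta> w
  define k' where "k' \<theta> w = (\<Sum>l\<in>UNIV. (s *\<^sub>R drot i j \<theta> w) $ l * G l (s *\<^sub>R rot i j \<theta> w)) * rot i j \<theta> w $ j +
    g (s *\<^sub>R rot i j \<theta> w) * drot i j \<theta> w $ j" for \<theta> w
  have rot_cont: "continuous_on X (\<lambda>z. rot i j (fst z) (snd z))" "continuous_on X (\<lambda>z. drot i j (fst z) (snd z))"
    for X :: "(real \<times> (real, 'n) vec) set"
    unfolding rot_def drot_def by (intro continuous_intros)+
  have rot_cont': "continuous_on X (rot i j \<theta>)" for X \<theta>
    using orthogonal_transformation_rot[OF ij] by (simp add: orthogonal_transformation linear_continuous_on linear_conv_bounded_linear)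
  have kc: "continuous_on (sphere 0 1) (k \<theta>)" for \<theta>
    unfolding k_def
    by (intro continuous_intros rot_cont' continuous_on_compose2[OF gb]) (use inb in auto)
  have "((\<lambda>\<theta>. \<integral>w. k \<theta> w \<partial>usm) has_vector_derivative (\<integral>w. k' 0 w \<partial>usm)) (at 0)"
  proof (rule has_vector_derivative_usm_integral[of UNIV])
    fix \<theta> :: real and w :: "(real, 'n) vec" assume w: "w \<in> sphere 0 1"
    have "((\<lambda>\<theta>. s *\<^sub>R rot i j \<theta> w) has_vector_derivative s *\<^sub>R drot i j \<theta> w) (at \<theta>)"
      by (rule bounded_linear.has_vector_derivative[OF bounded_linear_scaleR_right rot_has_vector_derivative])
    from has_real_derivative_grad[where G = G, OF g[OF inb[OF w]] this]
    have 1: "((\<lambda>\<theta>. g (s *\<^sub>R rot i j \<theta> w)) has_real_derivative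
        (\<Sum>l\<in>UNIV. (s *\<^sub>R drot i j \<theta> w) $ l * G l (s *\<^sub>R rot i j \<theta> w))) (at \<theta>)" .
    have 2: "((\<lambda>\<theta>. rot i j \<theta> w $ j) has_real_derivative drot i j \<theta> w $ j) (at \<theta>)"
      unfolding has_real_derivative_iff_has_vector_derivative
      by (rule bounded_linear.has_vector_derivative[OF bounded_linear_vec_nth rot_has_vector_derivative])
    show "((\<lambda>\<theta>. k \<theta> w) has_vector_derivative k' \<theta> w) (at \<theta>)"
      using DERIV_mult[OF 1 2] unfolding k_def k'_def has_real_derivative_iff_has_vector_derivative
      by (simp add: mult.commute)
  next
    show "continuous_on (UNIV \<times> sphere 0 1) (\<lambda>(\<theta>, w). k' \<theta> w)"
      unfolding split_beta k'_def using inb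
      by (intro continuous_intros rot_cont continuous_on_compose2[OF gb] continuous_on_compose2[OF G]) auto
  qed (auto intro: kc)
  moreover have "(\<integral>w. k \<theta> w \<partial>usm) = (\<integral>w. k 0 w \<partial>usm)" for \<theta>
  proof -
    have "(\<integral>w. k \<theta> w \<partial>usm) = (\<integral>w. g (s *\<^sub>R w) * w $ j \<partial>usm)" for \<theta>
      unfolding k_def using s
      by (intro integral_usm_orthogonal[OF orthogonal_transformation_rot[OF ij],
           where k = "\<lambda>w. g (s *\<^sub>R w) * w $ j"] continuous_intros continuous_on_compose2[OF gb]) auto
    then show ?thesis by simp
  qed
  then have "(\<lambda>\<theta>. \<integral>w. k \<theta> w \<partial>usm) = (\<lambda>\<theta>. \<integral>w. k 0 w \<partial>usm)" by blast
  ultimately have "((\<lambda>\<theta>::real. \<integral>w. k 0 w \<partial>usm) has_vector_derivative (\<integral>w. k' 0 w \<partial>usm)) (at 0)" by simp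
  then have "(\<integral>w. k' 0 w \<partial>usm) = 0"
    using vector_derivative_unique_at[OF _ has_vector_derivative_const] by blast
  moreover have "k' 0 w = s * (w $ i * G j (s *\<^sub>R w) - w $ j * G i (s *\<^sub>R w)) * w $ j + g (s *\<^sub>R w) * w $ i" for w
  proof -
    have rot0: "rot i j 0 w = w" by (simp add: rot_def)
    have drot0: "drot i j 0 w = w $ i *\<^sub>R axis j 1 - w $ j *\<^sub>R axis i 1" by (simp add: drot_def)
    have S: "(\<Sum>l\<in>UNIV. (s *\<^sub>R drot i j 0 w) $ l * G l (s *\<^sub>R w)) =
        s * w $ i * (\<Sum>l\<in>UNIV. axis j 1 $ l * G l (s *\<^sub>R w)) - s * w $ j * (\<Sum>l\<in>UNIV. axis i 1 $ l * G l (s *\<^sub>R w))"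
      unfolding drot0 by (simp only: sum_distrib_left sum_subtractf[symmetric]) (simp add: algebra_simps)
    have D: "drot i j 0 w $ j = w $ i" unfolding drot0 using ij by (simp add: axis_def)
    show ?thesis unfolding k'_def rot0 S D sum_axis_mult by (simp add: algebra_simps)
  qed
  ultimately show ?thesis by simp
qed

text \<open>The pair identities are summed over \<open>j \<noteq> i\<close> and simplified by \<Sum>
  \<open>w $ j * w $ j\<close> = 1. The factor n - 1 is the mean curvature term of the
  sphere.\<close>

lemma usm_tangential:
  fixes g :: "real^'n::{finite,wellorder} \<Rightarrow> real"
  assumes g: "\<And>y. y \<in> ball 0 \<rho> \<Longrightarrow> (g has_derivative (\<lambda>h. \<Sum>i\<in>UNIV. h $ i * G i y)) (at y)"
    and G: "\<And>i. continuous_on (ball 0 \<rho>) (G i)"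
    and s: "0 < s" "s < \<rho>"
  shows "s * (\<integral>w. G i (s *\<^sub>R w) \<partial>usm) = (real CARD('n) - 1) * (\<integral>w. w $ i * g (s *\<^sub>R w) \<partial>usm) +
    s * (\<integral>w. w $ i * (\<Sum>j\<in>UNIV. w $ j * G j (s *\<^sub>R w)) \<partial>usm)"
proof -
  have gb: "continuous_on (ball 0 \<rho>) g"
    by (rule continuous_at_imp_continuous_on) (blast intro: has_derivative_continuous g)
  have gc [continuous_intros]: "continuous_on (sphere 0 1) (\<lambda>w. g (s *\<^sub>R w))"
    using s by (intro continuous_on_compose2[OF gb] continuous_intros) auto
  have Gc [continuous_intros]: "continuous_on (sphere 0 1) (\<lambda>w. G j (s *\<^sub>R w))" for j
    using s by (intro continuous_on_compose2[OF G] continuous_intros) auto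
  let ?T = "\<lambda>j w. s * (w $ i * G j (s *\<^sub>R w) - w $ j * G i (s *\<^sub>R w)) * w $ j + g (s *\<^sub>R w) * w $ i"
  have "0 = (\<Sum>j\<in>UNIV - {i}. \<integral>w. ?T j w \<partial>usm)"
    using usm_tangential_pair[OF g G s] by (intro sum.neutral[symmetric]) auto
  also have "\<dots> = (\<integral>w. (\<Sum>j\<in>UNIV - {i}. ?T j w) \<partial>usm)"
    by (intro Bochner_Integration.integral_sum[symmetric] integrable_usm continuous_intros)
  also have "\<dots> = (\<integral>w. (s * (w $ i * (\<Sum>j\<in>UNIV. w $ j * G j (s *\<^sub>R w))) +
      (real CARD('n) - 1) * (w $ i * g (s *\<^sub>R w))) - s * G i (s *\<^sub>R w) \<partial>usm)"
  proof (rule integral_usm_cong)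
    fix w :: "(real, 'n) vec" assume "w \<in> sphere 0 1"
    then have "(\<Sum>j\<in>UNIV. w $ j * w $ j) = 1"
      by (simp add: norm_vec_def L2_set_def power2_eq_square real_sqrt_eq_1_iff)
    \<comment> \<open>At \<open>j = i\<close> the antisymmetric part cancels and only
      \<open>g (s w) w_i\<close> is left; removing it turns \<open>n\<close> copies into
      \<open>n - 1\<close>.\<close>
    have "(\<Sum>j\<in>UNIV - {i}. ?T j w) = (\<Sum>j\<in>UNIV. ?T j w) - ?T i w"
      by (simp add: sum_diff1)
    also have "(\<Sum>j\<in>UNIV. ?T j w) = s * (w $ i * (\<Sum>j\<in>UNIV. w $ j * G j (s *\<^sub>R w))) -
        s * G i (s *\<^sub>R w) * (\<Sum>j\<in>UNIV. w $ j * w $ j) + real CARD('n) * (g (s *\<^sub>R w) * w $ i)"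
      by (simp add: sum.distrib sum_subtractf sum_distrib_left algebra_simps)
    finally show "(\<Sum>j\<in>UNIV - {i}. ?T j w) = (s * (w $ i * (\<Sum>j\<in>UNIV. w $ j * G j (s *\<^sub>R w))) +
      (real CARD('n) - 1) * (w $ i * g (s *\<^sub>R w))) - s * G i (s *\<^sub>R w)"
      unfolding \<open>(\<Sum>j\<in>UNIV. w $ j * w $ j) = 1\<close> by (simp add: algebra_simps)
  qed
  also have "\<dots> = (s * (\<integral>w. w $ i * (\<Sum>j\<in>UNIV. w $ j * G j (s *\<^sub>R w)) \<partial>usm) +
      (real CARD('n) - 1) * (\<integral>w. w $ i * g (s *\<^sub>R w) \<partial>usm)) - s * (\<integral>w. G i (s *\<^sub>R w) \<partial>usm)"
  proof -
    have "integrable usm (\<lambda>w. w $ i * (\<Sum>j\<in>UNIV. w $ j * G j (s *\<^sub>R w)))"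
      "integrable usm (\<lambda>w. w $ i * g (s *\<^sub>R w))" "integrable usm (\<lambda>w. G i (s *\<^sub>R w))"
      by (intro integrable_usm continuous_intros)+
    then show ?thesis by simp
  qed
  finally show ?thesis by simp
qed

section \<open>Functions with vanishing derivative means\<close>

text \<open>The divergence theorem for the vector field with \<open>g\<close> as its only component,
  in direction \<open>i\<close>, differentiated in the radius: up to the surface normalisation, the
  left function is the flux through the sphere of radius \<open>s\<close>.\<close>

lemma usm_divergence:
  fixes g :: "real^'n::{finite,wellorder} \<Rightarrow> real"
  assumes g: "\<And>y. y \<in> ball 0 \<rho> \<Longrightarrow> (g has_derivative (\<lambda>h. \<Sum>i\<in>UNIV. h $ i * G i y)) (at y)"
    and G: "\<And>i. continuous_on (ball 0 \<rho>) (G i)"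
    and s: "0 < s" "s < \<rho>"
  shows "((\<lambda>s. s ^ (CARD('n) - 1) * (\<integral>w. w $ i * g (s *\<^sub>R w) \<partial>usm)) has_real_derivative
    s ^ (CARD('n) - 1) * (\<integral>w. G i (s *\<^sub>R w) \<partial>usm)) (at s)"
proof -
  define m where "m s = (\<integral>w. w $ i * g (s *\<^sub>R w) \<partial>usm)" for s
  define m' where "m' = (\<integral>w. w $ i * (\<Sum>j\<in>UNIV. w $ j * G j (s *\<^sub>R w)) \<partial>usm)"
  have "((\<lambda>s. \<integral>w. w $ i * g (0 + s *\<^sub>R w) \<partial>usm) has_real_derivative
      (\<integral>w. w $ i * (\<Sum>j\<in>UNIV. w $ j * G j (0 + s *\<^sub>R w)) \<partial>usm)) (at s)"
    using s by (intro usm_integral_line_derivative[where J = "{-\<rho><..<\<rho>}", OF g G]) (auto intro!: continuous_intros)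
  then have m: "(m has_real_derivative m') (at s)" by (simp add: m_def[abs_def] m'_def)
  \<comment> \<open>Dividing by \<open>s\<close> avoids the exponent n - 2, which would be truncated
    for n = 1.\<close>
  have pw: "((\<lambda>s. s ^ (CARD('n) - 1)) has_real_derivative (real CARD('n) - 1) * s ^ (CARD('n) - 1) / s) (at s)"
  proof -
    have "((\<lambda>s. s ^ (CARD('n) - 1)) has_real_derivative real (CARD('n) - 1) * s ^ (CARD('n) - 1 - 1)) (at s)"
      using DERIV_pow[of "CARD('n) - 1" s] by simp
    moreover have "real (CARD('n) - 1) * s ^ (CARD('n) - 1 - 1) = (real CARD('n) - 1) * s ^ (CARD('n) - 1) / s"
      using s of_nat_diff[of 1 "CARD('n)", where 'a = real]
      by (cases "CARD('n) - 1") (auto simp: Suc_leI)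
    ultimately show ?thesis by simp
  qed
  have "s * (\<integral>w. G i (s *\<^sub>R w) \<partial>usm) = (real CARD('n) - 1) * m s + s * m'"
    unfolding m_def m'_def by (rule usm_tangential[OF g G s])
  then have "(\<integral>w. G i (s *\<^sub>R w) \<partial>usm) = (real CARD('n) - 1) * m s / s + m'"
    using s by (simp add: field_simps)
  then have eq: "s ^ (CARD('n) - 1) * (\<integral>w. G i (s *\<^sub>R w) \<partial>usm) =
      (real CARD('n) - 1) * s ^ (CARD('n) - 1) / s * m s + m' * s ^ (CARD('n) - 1)"
    by (simp add: algebra_simps)
  show ?thesis
    unfolding eq m_def[symmetric] by (rule DERIV_mult[OF pw m])
qed

text \<open>All derivatives of \<open>g\<close>, of every order, have mean zero over the spheres of radius at most \<open>T\<close>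
  about \<open>0\<close>. Being a greatest fixed point, the class can be shown to be stable under multiplication
  by \<open>y\<^sub>i\<close> without a formula for higher derivatives of a product.\<close>

coinductive zero_means :: "real \<Rightarrow> real \<Rightarrow> (real^'n::{finite,wellorder} \<Rightarrow> real) \<Rightarrow> bool"
  for \<rho> T :: real
  where
    "\<lbrakk>\<forall>y\<in>ball 0 \<rho>. (g has_derivative (\<lambda>h. \<Sum>i\<in>UNIV. h $ i * G i y)) (at y);
      \<forall>i. zero_means \<rho> T (G i); \<forall>s. 0 < s \<and> s \<le> T \<longrightarrow> (\<integral>w. g (s *\<^sub>R w) \<partial>usm) = 0\<rbrakk>
    \<Longrightarrow> zero_means \<rho> T g"

lemma zero_means_cases:
  assumes "zero_means \<rho> T g"
  obtains G where
    "\<And>y. y \<in> ball 0 \<rho> \<Longrightarrow> (g has_derivative (\<lambda>h. \<Sum>i\<in>UNIV. h $ i * G i y)) (at y)"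
    "\<And>i. zero_means \<rho> T (G i)"
    "\<And>s. 0 < s \<Longrightarrow> s \<le> T \<Longrightarrow> (\<integral>w. g (s *\<^sub>R w) \<partial>usm) = 0"
  using assms
proof (cases rule: zero_means.cases)
  case (1 G)
  show thesis by (rule that[of G]) (simp_all add: 1)
qed

lemma zero_means_continuous_on:
  assumes "zero_means \<rho> T g"
  shows "continuous_on (ball 0 \<rho>) g"
  using assms
proof (rule zero_means_cases)
  fix G assume "\<And>y. y \<in> ball 0 \<rho> \<Longrightarrow> (g has_derivative (\<lambda>h. \<Sum>i\<in>UNIV. h $ i * G i y)) (at y)"
  then show ?thesis
    by (meson continuous_at_imp_continuous_on has_derivative_continuous)
qed

lemma zero_means_continuous_sphere:
  assumes "zero_means \<rho> T g" "0 < s" "s < \<rho>"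
  shows "continuous_on (sphere 0 1) (\<lambda>w. g (s *\<^sub>R w))"
  using assms(2,3)
  by (intro continuous_on_compose2[OF zero_means_continuous_on[OF assms(1)]] continuous_intros) auto

text \<open>Coinduction: combinations with the fixed coefficients \<open>a\<close>, \<open>b\<close>
  are stable under differentiation. \<open>T < \<rho>\<close> makes both integrands continuous on
  the spheres in question.\<close>

lemma zero_means_lincomb:
  assumes T: "T < \<rho>" and "zero_means \<rho> T g1" "zero_means \<rho> T g2"
  shows "zero_means \<rho> T (\<lambda>y. a * g1 y + b * g2 y)"
proof (rule zero_means.coinduct[where X = "\<lambda>h. \<exists>g1 g2. zero_means \<rho> T g1 \<and> zero_means \<rho> T g2 \<and>
    h = (\<lambda>y. a * g1 y + b * g2 y)"])
  show "\<exists>h1 h2. zero_means \<rho> T h1 \<and> zero_means \<rho> T h2 \<and>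
    (\<lambda>y. a * g1 y + b * g2 y) = (\<lambda>y. a * h1 y + b * h2 y)"
    using assms by blast
  fix h :: "(real, 'a) vec \<Rightarrow> real"
  assume "\<exists>g1 g2. zero_means \<rho> T g1 \<and> zero_means \<rho> T g2 \<and> h = (\<lambda>y. a * g1 y + b * g2 y)"
  then obtain g1 g2 where z: "zero_means \<rho> T g1" "zero_means \<rho> T g2"
    and h: "h = (\<lambda>y. a * g1 y + b * g2 y)" by blast
  from z(1) obtain G1 where G1:
    "\<And>y. y \<in> ball 0 \<rho> \<Longrightarrow> (g1 has_derivative (\<lambda>h. \<Sum>i\<in>UNIV. h $ i * G1 i y)) (at y)"
    "\<And>i. zero_means \<rho> T (G1 i)"
    "\<And>s. 0 < s \<Longrightarrow> s \<le> T \<Longrightarrow> (\<integral>w. g1 (s *\<^sub>R w) \<partial>usm) = 0" by (rule zero_means_cases) (rule that; simp)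
  from z(2) obtain G2 where G2:
    "\<And>y. y \<in> ball 0 \<rho> \<Longrightarrow> (g2 has_derivative (\<lambda>h. \<Sum>i\<in>UNIV. h $ i * G2 i y)) (at y)"
    "\<And>i. zero_means \<rho> T (G2 i)"
    "\<And>s. 0 < s \<Longrightarrow> s \<le> T \<Longrightarrow> (\<integral>w. g2 (s *\<^sub>R w) \<partial>usm) = 0" by (rule zero_means_cases) (rule that; simp)
  define G where "G i y = a * G1 i y + b * G2 i y" for i y
  have "(h has_derivative (\<lambda>v. \<Sum>i\<in>UNIV. v $ i * G i y)) (at y)" if "y \<in> ball 0 \<rho>" for y
  proof -
    have "(h has_derivative (\<lambda>v. a * (\<Sum>i\<in>UNIV. v $ i * G1 i y) + b * (\<Sum>i\<in>UNIV. v $ i * G2 i y))) (at y)"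
      unfolding h by (intro has_derivative_add has_derivative_mult_right G1 G2 that)
    then show ?thesis
      by (simp add: G_def algebra_simps sum.distrib sum_distrib_left)
  qed
  moreover have "(\<integral>w. h (s *\<^sub>R w) \<partial>usm) = 0" if "0 < s" "s \<le> T" for s
  proof -
    have "integrable usm (\<lambda>w. g1 (s *\<^sub>R w))" "integrable usm (\<lambda>w. g2 (s *\<^sub>R w))"
      using that T by (intro integrable_usm zero_means_continuous_sphere[OF z(1)]
        zero_means_continuous_sphere[OF z(2)]; simp)+
    then show ?thesis using G1(3) G2(3) that by (simp add: h)
  qed
  moreover have "\<exists>g1 g2. zero_means \<rho> T g1 \<and> zero_means \<rho> T g2 \<and> G i = (\<lambda>y. a * g1 y + b * g2 y)" for i
    using G1(2) G2(2) unfolding G_def by blast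
  ultimately show "\<exists>g G. h = g \<and> (\<forall>y\<in>ball 0 \<rho>. (g has_derivative (\<lambda>h. \<Sum>i\<in>UNIV. h $ i * G i y)) (at y)) \<and>
    (\<forall>i. (\<exists>g1 g2. zero_means \<rho> T g1 \<and> zero_means \<rho> T g2 \<and> G i = (\<lambda>y. a * g1 y + b * g2 y)) \<or> zero_means \<rho> T (G i)) \<and>
    (\<forall>s. 0 < s \<and> s \<le> T \<longrightarrow> (\<integral>w. g (s *\<^sub>R w) \<partial>usm) = 0)"
    by blast
qed

text \<open>\<open>g0\<close> only supplies the zero function, as \<open>0 * g0 + 0 * g0\<close>,
  for empty \<open>I\<close>.\<close>

lemma zero_means_sum:
  fixes g0 :: "(real, 'n::{finite,wellorder}) vec \<Rightarrow> real" and g :: "'i \<Rightarrow> (real, 'n) vec \<Rightarrow> real"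
  assumes T: "T < \<rho>" and "finite I" "zero_means \<rho> T g0" "\<And>i. i \<in> I \<Longrightarrow> zero_means \<rho> T (g i)"
  shows "zero_means \<rho> T (\<lambda>y. \<Sum>i\<in>I. c i * g i y)"
  using assms(2,4)
proof (induction I rule: finite_induct)
  case empty
  then show ?case using zero_means_lincomb[OF T assms(3,3), of 0 0] by simp
next
  case (insert i I)
  then show ?case using zero_means_lincomb[OF T, of "g i" "\<lambda>y. \<Sum>i\<in>I. c i * g i y" "c i" 1] by simp
qed

text \<open>Differentiating \<open>y $ i * g\<close> also produces \<open>g\<close> itself, so the
  coinduction runs over the larger class \<open>g1 + y $ i * g2\<close>, which is stable. The means
  of the second term vanish because, by \<open>usm_divergence\<close>, \<open>r ^ (n - 1)\<close>
  times the mean of \<open>w $ i * g2 (r w)\<close> is constant in \<open>r\<close> and starts at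
  0.\<close>

lemma zero_means_coord:
  fixes g :: "real^'n::{finite,wellorder} \<Rightarrow> real"
  assumes n: "CARD('n) \<ge> 2" and T: "T < \<rho>" and "zero_means \<rho> T g"
  shows "zero_means \<rho> T (\<lambda>y. y $ i * g y)"
proof (rule zero_means.coinduct[where X = "\<lambda>h. \<exists>g1 g2. zero_means \<rho> T g1 \<and> zero_means \<rho> T g2 \<and>
    h = (\<lambda>y. g1 y + y $ i * g2 y)"])
  have "zero_means \<rho> T (\<lambda>y. 0 * g y + 0 * g y)" using zero_means_lincomb[OF T assms(3,3)] .
  then show "\<exists>g1 g2. zero_means \<rho> T g1 \<and> zero_means \<rho> T g2 \<and> (\<lambda>y. y $ i * g y) = (\<lambda>y. g1 y + y $ i * g2 y)"
    using assms(3) by (intro exI[of _ "\<lambda>y. 0 * g y + 0 * g y"] exI[of _ g]) simp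
  fix h :: "(real, 'n) vec \<Rightarrow> real"
  assume "\<exists>g1 g2. zero_means \<rho> T g1 \<and> zero_means \<rho> T g2 \<and> h = (\<lambda>y. g1 y + y $ i * g2 y)"
  then obtain g1 g2 where z: "zero_means \<rho> T g1" "zero_means \<rho> T g2"
    and h: "h = (\<lambda>y. g1 y + y $ i * g2 y)" by blast
  from z(1) obtain G1 where G1:
    "\<And>y. y \<in> ball 0 \<rho> \<Longrightarrow> (g1 has_derivative (\<lambda>h. \<Sum>i\<in>UNIV. h $ i * G1 i y)) (at y)"
    "\<And>i. zero_means \<rho> T (G1 i)"
    "\<And>s. 0 < s \<Longrightarrow> s \<le> T \<Longrightarrow> (\<integral>w. g1 (s *\<^sub>R w) \<partial>usm) = 0" by (rule zero_means_cases) (rule that; simp)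
  from z(2) obtain G2 where G2:
    "\<And>y. y \<in> ball 0 \<rho> \<Longrightarrow> (g2 has_derivative (\<lambda>h. \<Sum>i\<in>UNIV. h $ i * G2 i y)) (at y)"
    "\<And>i. zero_means \<rho> T (G2 i)"
    "\<And>s. 0 < s \<Longrightarrow> s \<le> T \<Longrightarrow> (\<integral>w. g2 (s *\<^sub>R w) \<partial>usm) = 0" by (rule zero_means_cases) (rule that; simp)
  \<comment> \<open>\<open>K j\<close> collects the terms of the \<open>j\<close>-th derivative
    without the factor \<open>y $ i\<close>, among them the \<open>g2\<close> from the product rule
    when \<open>j = i\<close>.\<close>
  define K where "K j y = 1 * G1 j y + (if j = i then 1 else 0) * g2 y" for j y
  have K: "zero_means \<rho> T (K j)" for j
    unfolding K_def[abs_def] by (rule zero_means_lincomb[OF T G1(2) z(2)])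
  define G where "G j y = K j y + y $ i * G2 j y" for j y
  have "(h has_derivative (\<lambda>v. \<Sum>i\<in>UNIV. v $ i * G i y)) (at y)" if "y \<in> ball 0 \<rho>" for y
  proof -
    have "((\<lambda>y. y $ i) has_derivative (\<lambda>v. v $ i)) (at y)"
      by (rule bounded_linear_imp_has_derivative[OF bounded_linear_vec_nth])
    from has_derivative_add[OF G1(1)[OF that] has_derivative_mult[OF this G2(1)[OF that]]]
    have "(h has_derivative (\<lambda>v. (\<Sum>k\<in>UNIV. v $ k * G1 k y) +
        (y $ i * (\<Sum>k\<in>UNIV. v $ k * G2 k y) + v $ i * g2 y))) (at y)"
      unfolding h .
    also have "(\<lambda>v. (\<Sum>k\<in>UNIV. v $ k * G1 k y) + (y $ i * (\<Sum>k\<in>UNIV. v $ k * G2 k y) + v $ i * g2 y)) =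
        (\<lambda>v. \<Sum>i\<in>UNIV. v $ i * G i y)"
    proof
      fix v :: "(real, 'n) vec"
      have "(\<Sum>k\<in>UNIV. v $ k * ((if k = i then 1 else 0) * g2 y)) = v $ i * g2 y"
        by (simp add: if_distrib[of "\<lambda>x. x * _"] if_distrib[of "\<lambda>x. _ * x"] cong: if_cong)
      then show "(\<Sum>k\<in>UNIV. v $ k * G1 k y) + (y $ i * (\<Sum>k\<in>UNIV. v $ k * G2 k y) + v $ i * g2 y) =
          (\<Sum>i\<in>UNIV. v $ i * G i y)"
        by (simp add: G_def K_def distrib_left sum.distrib sum_distrib_left mult_ac)
    qed
    finally show ?thesis .
  qed
  moreover have "(\<integral>w. h (s *\<^sub>R w) \<partial>usm) = 0" if s: "0 < s" "s \<le> T" for s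
  proof -
    define \<Phi> where "\<Phi> r = r ^ (CARD('n) - 1) * (\<integral>w. w $ i * g2 (r *\<^sub>R w) \<partial>usm)" for r
    have "\<Phi> s = \<Phi> 0"
    proof (rule DERIV_isconst_end[OF s(1)])
      have "continuous_on ({0..s} \<times> sphere 0 1) (\<lambda>(r, w). w $ i * g2 (r *\<^sub>R w))"
        unfolding split_beta using s T
        by (intro continuous_intros continuous_on_compose2[OF zero_means_continuous_on[OF z(2)]]) auto
      then show "continuous_on {0..s} \<Phi>"
        unfolding \<Phi>_def by (intro continuous_intros continuous_on_usm_integral)
      fix r assume r: "0 < r" "r < s"
      have "(\<Phi> has_real_derivative r ^ (CARD('n) - 1) * (\<integral>w. G2 i (r *\<^sub>R w) \<partial>usm)) (at r)"
        unfolding \<Phi>_def using r s T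
        by (intro usm_divergence[OF G2(1) zero_means_continuous_on[OF G2(2)]]) auto
      moreover have "(\<integral>w. G2 i (r *\<^sub>R w) \<partial>usm) = 0"
        using G2(2)[of i] r s by (elim zero_means_cases) auto
      ultimately show "(\<Phi> has_real_derivative 0) (at r)" by simp
    qed
    \<comment> \<open>Here \<open>n \<ge> 2\<close> enters: the exponent of \<open>r\<close> is
      positive.\<close>
    also have "\<Phi> 0 = 0" using n by (simp add: \<Phi>_def power_0_left)
    finally have m: "(\<integral>w. w $ i * g2 (s *\<^sub>R w) \<partial>usm) = 0" using s by (simp add: \<Phi>_def)
    have "integrable usm (\<lambda>w. g1 (s *\<^sub>R w))" "integrable usm (\<lambda>w. w $ i * g2 (s *\<^sub>R w))"
      using s T by (intro integrable_usm continuous_intros zero_means_continuous_sphere[OF z(1)]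
        zero_means_continuous_sphere[OF z(2)]; simp)+
    then show ?thesis using G1(3)[OF s] m by (simp add: h mult.assoc)
  qed
  moreover have "\<exists>g1 g2. zero_means \<rho> T g1 \<and> zero_means \<rho> T g2 \<and> G j = (\<lambda>y. g1 y + y $ i * g2 y)" for j
    using K G2(2) unfolding G_def by blast
  ultimately show "\<exists>g G. h = g \<and> (\<forall>y\<in>ball 0 \<rho>. (g has_derivative (\<lambda>h. \<Sum>i\<in>UNIV. h $ i * G i y)) (at y)) \<and>
    (\<forall>j. (\<exists>g1 g2. zero_means \<rho> T g1 \<and> zero_means \<rho> T g2 \<and> G j = (\<lambda>y. g1 y + y $ i * g2 y)) \<or> zero_means \<rho> T (G j)) \<and>
    (\<forall>s. 0 < s \<and> s \<le> T \<longrightarrow> (\<integral>w. g (s *\<^sub>R w) \<partial>usm) = 0)"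
    by blast
qed

text \<open>Linear functions are combinations of coordinates. A product is handled by multiplying
  with one factor after the other, which is why the induction leaves \<open>g\<close>
  arbitrary.\<close>

lemma zero_means_polynomial:
  fixes p :: "real^'n::{finite,wellorder} \<Rightarrow> real"
  assumes n: "CARD('n) \<ge> 2" and T: "T < \<rho>" and "real_polynomial_function p" "zero_means \<rho> T g"
  shows "zero_means \<rho> T (\<lambda>y. p y * g y)"
  using assms(3,4)
proof (induction arbitrary: g)
  case (linear f)
  interpret f: bounded_linear f by fact
  have expand: "f y = (\<Sum>i\<in>UNIV. f (axis i 1) * y $ i)" for y
  proof -
    have "f y = f (\<Sum>i\<in>UNIV. y $ i *\<^sub>R axis i 1)"
      using basis_expansion[of y] by (simp add: scalar_mult_eq_scaleR)
    also have "\<dots> = (\<Sum>i\<in>UNIV. f (axis i 1) * y $ i)"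
      by (simp add: f.sum f.scaleR mult.commute)
    finally show ?thesis .
  qed
  have "(\<lambda>y. f y * g y) = (\<lambda>y. \<Sum>i\<in>UNIV. f (axis i 1) * (y $ i * g y))"
    by (rule ext, subst expand) (simp add: sum_distrib_right mult.assoc)
  then show ?case
    using zero_means_sum[OF T finite linear(2) zero_means_coord[OF n T linear(2)]] by simp
next
  case (const c)
  then show ?case using zero_means_lincomb[OF T const const, of c 0] by simp
next
  case (add f1 f2)
  then show ?case
    using zero_means_lincomb[OF T, of "\<lambda>y. f1 y * g y" "\<lambda>y. f2 y * g y" 1 1] by (simp add: distrib_right)
next
  case (mult f1 f2)
  then show ?case by (simp add: mult.assoc)
qed

text \<open>\<open>g\<close> is orthogonal to every polynomial on the sphere of radius
  \<open>s\<close>. With a polynomial \<open>p\<close> uniformly within \<open>e\<close> of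
  \<open>g\<close> there, the integral of the square of \<open>g\<close> equals that of
  \<open>(g - p) g\<close>, which is at most \<open>e * M\<close>.\<close>

lemma zero_means_imp_zero:
  fixes g :: "real^'n::{finite,wellorder} \<Rightarrow> real"
  assumes n: "CARD('n) \<ge> 2" and T: "T < \<rho>" and g: "zero_means \<rho> T g"
    and y: "y \<noteq> 0" "norm y \<le> T"
  shows "g y = 0"
proof -
  define s where "s = norm y"
  have s: "0 < s" "s \<le> T" "s < \<rho>" using y T by (auto simp: s_def)
  note gs = zero_means_continuous_sphere[OF g s(1,3)]
  define M where "M = (\<integral>w. \<bar>g (s *\<^sub>R w)\<bar> \<partial>usm)"
  have M: "0 \<le> M" unfolding M_def by simp
  have small: "(\<integral>w. (g (s *\<^sub>R w))\<^sup>2 \<partial>usm) \<le> e * M" if e: "e > 0" for e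
  proof -
    have "continuous_on (sphere 0 s) g"
      using s by (intro continuous_on_subset[OF zero_means_continuous_on[OF g]]) auto
    from Stone_Weierstrass_real_polynomial_function[OF compact_sphere this e]
    obtain p where p: "real_polynomial_function p" "\<And>x. x \<in> sphere 0 s \<Longrightarrow> \<bar>g x - p x\<bar> < e" by blast
    have pc: "continuous_on X p" for X
      using p(1) continuous_on_polymonial_function real_polynomial_function_eq by blast
    have pg: "(\<integral>w. p (s *\<^sub>R w) * g (s *\<^sub>R w) \<partial>usm) = 0"
      using zero_means_polynomial[OF n T p(1) g] s by (elim zero_means_cases) auto
    have [continuous_intros]: "continuous_on (sphere 0 1) (\<lambda>w. p (s *\<^sub>R w))"
      by (rule continuous_on_compose2[OF pc[of UNIV]]) (auto intro!: continuous_intros)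
    have "(\<integral>w. (g (s *\<^sub>R w))\<^sup>2 \<partial>usm) = (\<integral>w. (g (s *\<^sub>R w) - p (s *\<^sub>R w)) * g (s *\<^sub>R w) + p (s *\<^sub>R w) * g (s *\<^sub>R w) \<partial>usm)"
      by (simp add: power2_eq_square algebra_simps)
    also have "\<dots> = (\<integral>w. (g (s *\<^sub>R w) - p (s *\<^sub>R w)) * g (s *\<^sub>R w) \<partial>usm)"
      by (subst Bochner_Integration.integral_add) (auto intro!: integrable_usm continuous_intros gs simp: pg)
    also have "\<dots> \<le> (\<integral>w. e * \<bar>g (s *\<^sub>R w)\<bar> \<partial>usm)"
    proof (intro integral_mono integrable_usm continuous_intros gs)
      fix w :: "(real, 'n) vec" assume "w \<in> space usm"
      then have "\<bar>g (s *\<^sub>R w) - p (s *\<^sub>R w)\<bar> \<le> e" using p(2)[of "s *\<^sub>R w"] s by simp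
      then have "\<bar>(g (s *\<^sub>R w) - p (s *\<^sub>R w)) * g (s *\<^sub>R w)\<bar> \<le> e * \<bar>g (s *\<^sub>R w)\<bar>"
        unfolding abs_mult by (rule mult_right_mono) simp
      then show "(g (s *\<^sub>R w) - p (s *\<^sub>R w)) * g (s *\<^sub>R w) \<le> e * \<bar>g (s *\<^sub>R w)\<bar>" by linarith
    qed
    also have "\<dots> = e * M" by (simp add: M_def)
    finally show ?thesis .
  qed
  have "(\<integral>w. (g (s *\<^sub>R w))\<^sup>2 \<partial>usm) \<le> 0 + e" if "e > 0" for e
  proof -
    \<comment> \<open>The added 1 allows for \<open>M = 0\<close>.\<close>
    have "e / (M + 1) > 0" using that M by simp
    from small[OF this] have "(\<integral>w. (g (s *\<^sub>R w))\<^sup>2 \<partial>usm) \<le> e / (M + 1) * M" .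
    also have "\<dots> \<le> e" using that M by (simp add: field_simps)
    finally show ?thesis by simp
  qed
  then have "(\<integral>w. (g (s *\<^sub>R w))\<^sup>2 \<partial>usm) \<le> 0" by (rule field_le_epsilon)
  moreover have "0 \<le> (\<integral>w. (g (s *\<^sub>R w))\<^sup>2 \<partial>usm)" by simp
  ultimately have "(\<integral>w. (g (s *\<^sub>R w))\<^sup>2 \<partial>usm) = 0" by linarith
  from usm_nonneg_zero[OF _ _ this, of "y /\<^sub>R s"]
  have "(g (s *\<^sub>R (y /\<^sub>R s)))\<^sup>2 = 0"
    using s gs by (simp add: s_def continuous_on_power)
  then show ?thesis using s by simp
qed

text \<open>The members of a jet, translated to the centre \<open>a\<close>, are closed under
  differentiation and so witness the coinduction. The centre is left out because
  \<open>zero_means\<close> speaks of positive radii.\<close>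

lemma jet_zero_means_imp_zero:
  fixes F :: "'n list \<Rightarrow> real^'n::{finite,wellorder} \<Rightarrow> real"
  assumes n: "CARD('n) \<ge> 2" and F: "jet U F" and U: "ball a \<rho> \<subseteq> U" and T: "T < \<rho>"
    and means: "\<And>is s. 0 < s \<Longrightarrow> s \<le> T \<Longrightarrow> (\<integral>w. F is (a + s *\<^sub>R w) \<partial>usm) = 0"
    and y: "y \<noteq> a" "dist a y \<le> T"
  shows "F is y = 0"
proof -
  have "zero_means \<rho> T (\<lambda>y. F is (a + y))"
  proof (rule zero_means.coinduct[where X = "\<lambda>h. \<exists>is. h = (\<lambda>y. F is (a + y))"])
    show "\<exists>is'. (\<lambda>y. F is (a + y)) = (\<lambda>y. F is' (a + y))" by blast
    fix h assume "\<exists>is. h = (\<lambda>y. F is (a + y))"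
    then obtain "is" where h: "h = (\<lambda>y. F is (a + y))" by blast
    have "(h has_derivative (\<lambda>v. \<Sum>i\<in>UNIV. v $ i * F (i # is) (a + y))) (at y)" if "y \<in> ball 0 \<rho>" for y
    proof -
      have "a + y \<in> ball a \<rho>" using that by (simp add: dist_norm)
      then have "a + y \<in> U" using U by blast
      have "((\<lambda>y. a + y) has_derivative (\<lambda>v. v)) (at y)" by (auto intro!: derivative_eq_intros)
      from has_derivative_compose[OF this jet_has_derivative[OF F \<open>a + y \<in> U\<close>]]
      show ?thesis unfolding h .
    qed
    then show "\<exists>g G. h = g \<and> (\<forall>y\<in>ball 0 \<rho>. (g has_derivative (\<lambda>h. \<Sum>i\<in>UNIV. h $ i * G i y)) (at y)) \<and>
      (\<forall>i. (\<exists>is. G i = (\<lambda>y. F is (a + y))) \<or> zero_means \<rho> T (G i)) \<and>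
      (\<forall>s. 0 < s \<and> s \<le> T \<longrightarrow> (\<integral>w. g (s *\<^sub>R w) \<partial>usm) = 0)"
      using means unfolding h
      by (intro exI[of _ "\<lambda>y. F is (a + y)"] exI[of _ "\<lambda>i y. F (i # is) (a + y)"]) auto
  qed
  from zero_means_imp_zero[OF n T this, of "y - a"] y show ?thesis
    by (simp add: dist_norm norm_minus_commute)
qed

section \<open>The energy estimate\<close>

text \<open>For \<open>P = \<partial>\<^sub>s W\<close> and \<open>Q = \<partial>\<^sub>t W\<close> with \<open>W\<close> a solution of
  \<open>W\<^sub>s\<^sub>s + (m/s) W\<^sub>s = W\<^sub>t\<^sub>t + (m/t) W\<^sub>t\<close>, \<open>s\<close> plays the role of time, and \<open>L\<close> is the common value of
  both sides. The energy \<open>\<integral>\<^sub>0\<^sup>R t\<^sup>m (P\<^sup>2 + Q\<^sup>2) dt\<close> does not increase, since the term \<open>(m/s) P\<close> is a damping.\<close>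

lemma darboux_energy_vanishing:
  fixes P Q Ps X L :: "real \<Rightarrow> real \<Rightarrow> real"
  assumes R: "R > 0" and m: "m \<ge> 1"
    and P_s: "\<And>s t. s \<in> {0..<\<epsilon>} \<Longrightarrow> t \<in> {0..R} \<Longrightarrow> ((\<lambda>s. P s t) has_real_derivative Ps s t) (at s)"
    and Q_s: "\<And>s t. s \<in> {0..<\<epsilon>} \<Longrightarrow> t \<in> {0..R} \<Longrightarrow> ((\<lambda>s. Q s t) has_real_derivative X s t) (at s)"
    and P_t: "\<And>s t. s \<in> {0..<\<epsilon>} \<Longrightarrow> t \<in> {0<..<R} \<Longrightarrow> ((\<lambda>t. P s t) has_real_derivative X s t) (at t)"
    and Q_t: "\<And>s t. s \<in> {0..<\<epsilon>} \<Longrightarrow> t \<in> {0<..<R} \<Longrightarrow>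
      ((\<lambda>t. t ^ m * Q s t) has_real_derivative t ^ m * L s t) (at t)"
    and L: "\<And>s t. s \<in> {0<..<\<epsilon>} \<Longrightarrow> t \<in> {0..R} \<Longrightarrow> s * L s t = real m * P s t + s * Ps s t"
    and cP: "continuous_on ({0..<\<epsilon>} \<times> {0..R}) (\<lambda>(s, t). P s t)"
    and cQ: "continuous_on ({0..<\<epsilon>} \<times> {0..R}) (\<lambda>(s, t). Q s t)"
    and cPs: "continuous_on ({0..<\<epsilon>} \<times> {0..R}) (\<lambda>(s, t). Ps s t)"
    and cX: "continuous_on ({0..<\<epsilon>} \<times> {0..R}) (\<lambda>(s, t). X s t)"
    and PR: "\<And>s. s \<in> {0..<\<epsilon>} \<Longrightarrow> P s R = 0"
    and P0: "\<And>t. t \<in> {0..R} \<Longrightarrow> P 0 t = 0" and Q0: "\<And>t. t \<in> {0..R} \<Longrightarrow> Q 0 t = 0"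
    and st: "s \<in> {0..<\<epsilon>}" "t \<in> {0<..R}"
  shows "P s t = 0"
proof -
  define I where "I = {0..<\<epsilon>}"
  define e where "e s t = t ^ m * ((P s t)\<^sup>2 + (Q s t)\<^sup>2)" for s t
  define e' where "e' s t = t ^ m * (2 * P s t * Ps s t + 2 * Q s t * X s t)" for s t
  define E where "E s = integral (cbox 0 R) (e s)" for s
  have slice: "continuous_on {0..R} (f s)" if "continuous_on ({0..<\<epsilon>} \<times> {0..R}) (\<lambda>(s, t). f s t)" "s \<in> I"
    for f :: "real \<Rightarrow> real \<Rightarrow> real" and s
    using continuous_on_compose2[OF that(1), of "{0..R}" "\<lambda>t. (s, t)"] that(2)
    by (simp add: I_def continuous_on_Pair image_subset_iff)
  have ce: "continuous_on {0..R} (e s)" if "s \<in> I" for s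
    unfolding e_def by (intro continuous_intros slice[OF cP that] slice[OF cQ that])
  have e_s: "((\<lambda>s. e s t) has_real_derivative e' s t) (at s)" if "s \<in> I" "t \<in> {0..R}" for s t
    unfolding e_def e'_def
    using P_s[of s t] Q_s[of s t] that unfolding I_def
    by (auto intro!: derivative_eq_intros simp: algebra_simps)
  have ce': "continuous_on (I \<times> cbox 0 R) (\<lambda>(s, t). e' s t)"
    using cP cQ cPs cX unfolding e'_def I_def split_beta cbox_interval by (intro continuous_intros)
  have E_s: "(E has_real_derivative integral (cbox 0 R) (e' s)) (at s within I)" if "s \<in> I" for s
    unfolding E_def
  proof (rule leibniz_rule_field_derivative[OF _ _ ce' that])
    show "((\<lambda>s. e s t) has_real_derivative e' s t) (at s within I)" if "s \<in> I" "t \<in> cbox 0 R" for s t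
      using e_s[of s t] that by (simp add: has_field_derivative_at_within)
    show "e s integrable_on cbox 0 R" if "s \<in> I" for s
      using ce[OF that] by (simp add: integrable_continuous_interval)
  qed (simp add: I_def)
  have nonpos: "integral (cbox 0 R) (e' s) \<le> 0" if s: "s \<in> {0<..<\<epsilon>}" for s
  proof -
    have sI: "s \<in> I" using s by (simp add: I_def)
    \<comment> \<open>\<open>D\<close> is the derivative in \<open>t\<close> of
      \<open>t ^ m * Q s t * P s t\<close>. Its integral is zero: \<open>P\<close> vanishes at
      \<open>t = R\<close>, and \<open>0 ^ m = 0\<close> because \<open>m \<ge> 1\<close>.\<close>
    define D where "D t = t ^ m * L s t * P s t + X s t * (t ^ m * Q s t)" for t
    have "(D has_integral (R ^ m * Q s R * P s R - 0 ^ m * Q s 0 * P s 0)) {0..R}"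
    proof (rule fundamental_theorem_of_calculus_interior)
      show "continuous_on {0..R} (\<lambda>t. t ^ m * Q s t * P s t)"
        by (intro continuous_intros slice[OF cP sI] slice[OF cQ sI])
      fix t assume "t \<in> {0<..<R}"
      then show "((\<lambda>t. t ^ m * Q s t * P s t) has_vector_derivative D t) (at t)"
        using DERIV_mult[OF Q_t P_t, of s t s] sI unfolding D_def I_def
        by (simp add: has_real_derivative_iff_has_vector_derivative)
    qed (use R in simp)
    then have "(D has_integral 0) {0..R}" using PR[of s] s m by (simp add: power_0_left)
    from has_integral_mult_right[OF this, of "2 * s"]
    have D: "((\<lambda>t. 2 * s * D t) has_integral 0) {0..R}" by simp
    have "continuous_on {0..R} (e' s)"
      using continuous_on_compose2[OF ce', of "{0..R}" "\<lambda>t. (s, t)"] sI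
      by (simp add: continuous_on_Pair image_subset_iff)
    then have "(e' s has_integral integral (cbox 0 R) (e' s)) {0..R}"
      by (simp add: integrable_continuous_interval integrable_integral)
    from has_integral_mult_right[OF this, of s]
    \<comment> \<open>The sign is found after multiplication by \<open>s\<close>, because the
      equation \<open>L\<close> is stated without division by \<open>s\<close>. The integrand
      exceeds that of \<open>D\<close> by the damping term \<open>- 2 m t ^ m P^2\<close>, which is
      at most 0.\<close>
    have "s * integral (cbox 0 R) (e' s) \<le> 0"
    proof (rule has_integral_le[OF _ D])
      fix t assume t: "t \<in> {0..R}"
      have "s * e' s t = 2 * t ^ m * P s t * (s * Ps s t) + 2 * s * (t ^ m * Q s t * X s t)"
        by (simp add: e'_def algebra_simps)
      also have "s * Ps s t = s * L s t - real m * P s t" using L[OF s t] by simp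
      finally have "s * e' s t = 2 * s * D t - 2 * (real m * t ^ m * (P s t)\<^sup>2)"
        by (simp add: D_def algebra_simps power2_eq_square)
      moreover have "0 \<le> real m * t ^ m * (P s t)\<^sup>2" using t by simp
      ultimately show "s * e' s t \<le> 2 * s * D t" by linarith
    qed
    then show ?thesis using s by (simp add: mult_le_0_iff)
  qed
  have "E s \<le> E 0"
  proof (cases "s = 0")
    case False
    then have "0 < s" using st by simp
    then show ?thesis
    \<comment> \<open>The sign of the derivative is known for positive times only; at time 0
      continuity of \<open>E\<close> suffices.\<close>
    proof (rule DERIV_nonpos_imp_decreasing_open[OF less_imp_le])
      fix x assume x: "0 < x" "x < s"
      then have "x \<in> interior I" using st by (simp add: I_def interior_atLeastLessThan)
      then have "(E has_real_derivative integral (cbox 0 R) (e' x)) (at x)"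
        using E_s[of x] interior_subset[of I] by (metis at_within_interior subsetD)
      moreover have "integral (cbox 0 R) (e' x) \<le> 0" using x st by (intro nonpos) auto
      ultimately show "\<exists>y. (E has_real_derivative y) (at x) \<and> y \<le> 0" by blast
    next
      have "continuous_on I E" using E_s by (rule DERIV_continuous_on)
      then show "continuous_on {0..s} E" using st by (auto simp: I_def intro: continuous_on_subset)
    qed
  qed simp
  also have "E 0 = integral (cbox 0 R) (\<lambda>t. 0)"
    unfolding E_def using P0 Q0 by (intro integral_cong) (simp add: e_def)
  finally have "E s \<le> 0" by simp
  moreover have "0 \<le> E s"
    unfolding E_def by (rule integral_nonneg)
      (use ce[of s] st in \<open>auto simp: I_def e_def integrable_continuous_interval\<close>)
  ultimately have "integral {0..R} (e s) = 0" by (simp add: E_def)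
  moreover have "e s t \<ge> 0" if "t \<in> {0..R}" for t using that by (simp add: e_def)
  moreover have "e s integrable_on {0..R}"
    using ce[of s] st by (simp add: I_def integrable_continuous_interval)
  ultimately have "e s t = 0"
    using has_integral_0_cbox_imp_0[of 0 R "e s" t] ce[of s] R st
    by (auto simp: I_def has_integral_iff)
  \<comment> \<open>The weight \<open>t ^ m\<close> cancels since \<open>t > 0\<close>.\<close>
  then have "(P s t)\<^sup>2 + (Q s t)\<^sup>2 = 0" using st by (simp add: e_def)
  then show ?thesis by (simp add: sum_power2_eq_zero_iff)
qed

section \<open>Iterated spherical means\<close>

lemma jet_sum:
  assumes "open U" "\<And>j. j \<in> I \<Longrightarrow> jet U (F j)"
  shows "jet U (\<lambda>is x. \<Sum>j\<in>I. F j is x)"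
  unfolding jet_def
proof (intro conjI allI ballI assms(1))
  fix "is" x assume "x \<in> U"
  then have "((\<lambda>x. \<Sum>j\<in>I. F j is x) has_derivative (\<lambda>h. \<Sum>j\<in>I. \<Sum>i\<in>UNIV. h $ i * F j (i # is) x)) (at x)"
    using assms(2) by (intro has_derivative_sum jet_has_derivative) auto
  then show "((\<lambda>x. \<Sum>j\<in>I. F j is x) has_derivative (\<lambda>h. \<Sum>i\<in>UNIV. h $ i * (\<Sum>j\<in>I. F j (i # is) x))) (at x)"
    by (simp add: sum_distrib_left sum.swap[of _ I])
qed

lemma jet_cong:
  assumes "jet U F" "\<And>is x. x \<in> U \<Longrightarrow> F' is x = F is x"
  shows "jet U F'"
  unfolding jet_def
proof (intro conjI allI ballI)
  show "open U" using assms(1) by (rule jet_open)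
  fix "is" x assume x: "x \<in> U"
  have "(F is has_derivative (\<lambda>h. \<Sum>i\<in>UNIV. h $ i * F' (i # is) x)) (at x)"
    using jet_has_derivative[OF assms(1) x] x by (simp add: assms(2))
  then show "(F' is has_derivative (\<lambda>h. \<Sum>i\<in>UNIV. h $ i * F' (i # is) x)) (at x)"
    by (rule has_derivative_transform_within_open[OF _ jet_open[OF assms(1)] x]) (simp add: assms(2))
qed

section \<open>Means over moving spheres and the Euler-Poisson-Darboux equation\<close>

locale ball_jet =
  fixes F :: "'n list \<Rightarrow> (real, 'n::{finite,wellorder}) vec \<Rightarrow> real" and \<rho> :: real
  assumes F: "jet (ball 0 \<rho>) F"
begin

definition V :: "'n list \<Rightarrow> real \<Rightarrow> (real, 'n) vec \<Rightarrow> real"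
  where "V is t x = (\<integral>w. F is (x + t *\<^sub>R w) \<partial>usm)"

text \<open>The integral of the derivative of \<open>F is\<close> along the outer normal, that is,
  the derivative of \<open>V\<close> in \<open>t\<close>. The sum stands outside the integral so
  that \<open>usm_divergence\<close> applies to each term.\<close>

definition B :: "'n list \<Rightarrow> real \<Rightarrow> (real, 'n) vec \<Rightarrow> real"
  where "B is t x = (\<Sum>i\<in>UNIV. \<integral>w. w $ i * F (i # is) (x + t *\<^sub>R w) \<partial>usm)"

definition cone :: "(real \<times> (real, 'n) vec) set"
  where "cone = {(t, x). \<bar>t\<bar> + norm x < \<rho>}"

lemma in_ball: "\<bar>t\<bar> + norm x < \<rho> \<Longrightarrow> w \<in> sphere 0 1 \<Longrightarrow> x + t *\<^sub>R w \<in> ball 0 \<rho>"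
  using norm_triangle_ineq[of x "t *\<^sub>R w"] by simp

lemma F_cont [continuous_intros]:
  assumes "continuous_on X f" "\<And>z. z \<in> X \<Longrightarrow> f z \<in> ball 0 \<rho>"
  shows "continuous_on X (\<lambda>z. F is (f z))"
  using assms by (intro continuous_on_compose2[OF jet_continuous_on[OF F]]) auto

lemma weighted_jet:
  assumes p: "continuous_on (sphere 0 1) p"
  shows "jet (ball 0 (\<rho> - \<bar>t\<bar>)) (\<lambda>is x. \<integral>w. p w * F is (x + t *\<^sub>R w) \<partial>usm)"
  unfolding jet_def
proof (intro conjI allI ballI open_ball)
  fix "is" :: "'n list" and x :: "(real, 'n) vec" assume x: "x \<in> ball 0 (\<rho> - \<bar>t\<bar>)"
  show "((\<lambda>x. \<integral>w. p w * F is (x + t *\<^sub>R w) \<partial>usm) has_derivative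
      (\<lambda>h. \<Sum>i\<in>UNIV. h $ i * (\<integral>w. p w * F (i # is) (x + t *\<^sub>R w) \<partial>usm))) (at x)"
    by (rule usm_integral_translate_derivative[OF jet_has_derivative[OF F] jet_continuous_on[OF F] open_ball x _ p])
      (assumption, rule in_ball, auto)
qed

lemma V_jet: "jet (ball 0 (\<rho> - \<bar>t\<bar>)) (\<lambda>is. V is t)"
  using weighted_jet[of "\<lambda>_. 1" t] by (simp add: V_def[abs_def])

text \<open>In \<open>B\<close> the index \<open>i\<close> comes after those in \<open>is\<close>,
  whereas further derivatives of a jet are added at the head. Moving \<open>i\<close> to the far end
  of the list makes each term an instance of \<open>weighted_jet\<close>.\<close>

lemma B_jet: "jet (ball 0 (\<rho> - \<bar>t\<bar>)) (\<lambda>is. B is t)"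
proof (rule jet_cong[OF jet_sum[OF open_ball]])
  fix j :: 'n
  show "jet (ball 0 (\<rho> - \<bar>t\<bar>)) (\<lambda>is x. \<integral>w. w $ j * F (is @ [j]) (x + t *\<^sub>R w) \<partial>usm)"
    by (rule ball_jet.weighted_jet) (auto simp: ball_jet_def intro: jet_append[OF F] continuous_intros)
next
  fix "is" and x :: "(real, 'n) vec" assume x: "x \<in> ball 0 (\<rho> - \<bar>t\<bar>)"
  have move: "F (j # is) y = F (is @ [j]) y" if "y \<in> ball 0 \<rho>" for j "is" y
    using that
  proof (induction "is" arbitrary: y)
    case (Cons i "is")
    have eq: "F (j # is) z = F (is @ [j]) z" if "z \<in> ball 0 \<rho>" for z by (rule Cons.IH[OF that])
    have "(F (is @ [j]) has_derivative (\<lambda>h. \<Sum>k\<in>UNIV. h $ k * F (k # j # is) y)) (at y)"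
      by (rule has_derivative_transform_within_open[OF jet_has_derivative[OF F Cons.prems] open_ball Cons.prems eq])
    from has_derivative_unique[OF this jet_has_derivative[OF F Cons.prems]]
    have "(\<Sum>k\<in>UNIV. axis i 1 $ k * F (k # j # is) y) = (\<Sum>k\<in>UNIV. axis i 1 $ k * F (k # is @ [j]) y)"
      by (rule fun_cong)
    then have "F (i # j # is) y = F (i # is @ [j]) y" unfolding sum_axis_mult .
    then show ?case using jet_commute[OF F Cons.prems, of i j "is"] by simp
  qed simp
  show "B is t x = (\<Sum>j\<in>UNIV. \<integral>w. w $ j * F (is @ [j]) (x + t *\<^sub>R w) \<partial>usm)"
    unfolding B_def using x by (intro sum.cong integral_usm_cong refl arg_cong2[where f = "(*)"] move in_ball) auto
qed

lemma V_joint_cont: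
  assumes "continuous_on X f" "continuous_on X g" "\<And>z. z \<in> X \<Longrightarrow> \<bar>f z\<bar> + norm (g z) < \<rho>"
  shows "continuous_on X (\<lambda>z. V is (f z) (g z))"
proof -
  have "continuous_on cone (\<lambda>(t, x). V is t x)"
    unfolding V_def split_beta
    by (intro continuous_on_usm_integral) (auto simp: split_beta cone_def simp del: mem_ball intro!: continuous_intros in_ball)
  from continuous_on_compose2[OF this continuous_on_Pair[OF assms(1,2)]]
  show ?thesis using assms(3) by (auto simp: cone_def image_subset_iff)
qed

lemma B_joint_cont:
  assumes "continuous_on X f" "continuous_on X g" "\<And>z. z \<in> X \<Longrightarrow> \<bar>f z\<bar> + norm (g z) < \<rho>"
  shows "continuous_on X (\<lambda>z. B is (f z) (g z))"
proof -
  have "continuous_on cone (\<lambda>(t, x). B is t x)"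
    unfolding B_def split_beta
    by (intro continuous_on_sum continuous_on_usm_integral)
      (auto simp: split_beta cone_def simp del: mem_ball intro!: continuous_intros in_ball)
  from continuous_on_compose2[OF this continuous_on_Pair[OF assms(1,2)]]
  show ?thesis using assms(3) by (auto simp: cone_def image_subset_iff)
qed

lemma V_t:
  assumes "\<bar>t\<bar> + norm x < \<rho>"
  shows "((\<lambda>t. V is t x) has_real_derivative B is t x) (at t)"
proof -
  have "((\<lambda>t. \<integral>w. 1 * F is (x + t *\<^sub>R w) \<partial>usm) has_real_derivative
      (\<integral>w. 1 * (\<Sum>i\<in>UNIV. w $ i * F (i # is) (x + t *\<^sub>R w)) \<partial>usm)) (at t)"
  proof (rule usm_integral_line_derivative[OF jet_has_derivative[OF F] jet_continuous_on[OF F],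
          where J = "{- (\<rho> - norm x) <..< \<rho> - norm x}"])
    fix r :: real and w :: "(real, 'n) vec" assume "r \<in> {- (\<rho> - norm x) <..< \<rho> - norm x}" "w \<in> sphere 0 1"
    then show "x + r *\<^sub>R w \<in> ball 0 \<rho>" by (intro in_ball) auto
  qed (use assms in \<open>auto intro!: continuous_intros\<close>)
  also have "(\<integral>w. 1 * (\<Sum>i\<in>UNIV. w $ i * F (i # is) (x + t *\<^sub>R w)) \<partial>usm) = B is t x"
    unfolding B_def mult_1
    by (intro Bochner_Integration.integral_sum integrable_usm continuous_intros in_ball[OF assms])
  finally show ?thesis by (simp add: V_def)
qed

text \<open>Darboux's equation for the mean: \<open>usm_divergence\<close> about the centre
  \<open>x\<close>, applied to each first derivative and summed, turns the flux of the gradient into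
  the mean of the Laplacian.\<close>

lemma B_t:
  assumes "0 < t" "t + norm x < \<rho>"
  shows "((\<lambda>t. t ^ (CARD('n) - 1) * B is t x) has_real_derivative
    t ^ (CARD('n) - 1) * (\<Sum>i\<in>UNIV. V (i # i # is) t x)) (at t)"
proof -
  have "((\<lambda>t. t ^ (CARD('n) - 1) * (\<integral>w. w $ i * F (i # is) (x + t *\<^sub>R w) \<partial>usm)) has_real_derivative
      t ^ (CARD('n) - 1) * (\<integral>w. F (i # i # is) (x + t *\<^sub>R w) \<partial>usm)) (at t)" for i
  proof (rule usm_divergence[where \<rho> = "\<rho> - norm x" and g = "\<lambda>y. F (i # is) (x + y)"
        and G = "\<lambda>j y. F (j # i # is) (x + y)"])
    fix y :: "(real, 'n) vec" assume "y \<in> ball 0 (\<rho> - norm x)"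
    then have y: "x + y \<in> ball 0 \<rho>" using norm_triangle_ineq[of x y] by simp
    have "((\<lambda>y. x + y) has_derivative (\<lambda>v. v)) (at y)" by (auto intro!: derivative_eq_intros)
    from has_derivative_compose[OF this jet_has_derivative[OF F y]]
    show "((\<lambda>y. F (i # is) (x + y)) has_derivative (\<lambda>h. \<Sum>j\<in>UNIV. h $ j * F (j # i # is) (x + y))) (at y)" .
  next
    fix j
    have "x + y \<in> ball 0 \<rho>" if "y \<in> ball 0 (\<rho> - norm x)" for y :: "(real, 'n) vec"
      using norm_triangle_ineq[of x y] that by simp
    then show "continuous_on (ball 0 (\<rho> - norm x)) (\<lambda>y. F (j # i # is) (x + y))"
      by (intro continuous_intros)
  qed (use assms in auto)
  then show ?thesis unfolding B_def V_def sum_distrib_left by (intro DERIV_sum)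
qed

text \<open>For the iterated mean \<open>W(s,t) = \<integral>\<integral> F [] (s w + t v) dv dw\<close>, \<open>P\<close>, \<open>Ps\<close>, \<open>Q\<close>, \<open>X\<close> are
  \<open>W\<^sub>s\<close>, \<open>W\<^sub>s\<^sub>s\<close>, \<open>W\<^sub>t\<close>, \<open>W\<^sub>s\<^sub>t\<close>, and \<open>L\<close> is the iterated mean of the Laplacian.\<close>

definition P :: "real \<Rightarrow> real \<Rightarrow> real"
  where "P s t = (\<Sum>j\<in>UNIV. \<integral>w. w $ j * V [j] t (s *\<^sub>R w) \<partial>usm)"

definition Ps :: "real \<Rightarrow> real \<Rightarrow> real"
  where "Ps s t = (\<Sum>j\<in>UNIV. \<integral>w. w $ j * (\<Sum>k\<in>UNIV. w $ k * V [k, j] t (s *\<^sub>R w)) \<partial>usm)"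

definition Q :: "real \<Rightarrow> real \<Rightarrow> real"
  where "Q s t = (\<integral>w. B [] t (s *\<^sub>R w) \<partial>usm)"

definition X :: "real \<Rightarrow> real \<Rightarrow> real"
  where "X s t = (\<Sum>j\<in>UNIV. \<integral>w. w $ j * B [j] t (s *\<^sub>R w) \<partial>usm)"

definition L :: "real \<Rightarrow> real \<Rightarrow> real"
  where "L s t = (\<integral>w. (\<Sum>i\<in>UNIV. V [i, i] t (s *\<^sub>R w)) \<partial>usm)"

lemma V_cont_sphere: "\<bar>s\<bar> + \<bar>t\<bar> < \<rho> \<Longrightarrow> continuous_on (sphere 0 1) (\<lambda>w. V is t (s *\<^sub>R w))"
  by (intro V_joint_cont continuous_intros) auto

lemma B_cont_sphere: "\<bar>s\<bar> + \<bar>t\<bar> < \<rho> \<Longrightarrow> continuous_on (sphere 0 1) (\<lambda>w. B is t (s *\<^sub>R w))"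
  by (intro B_joint_cont continuous_intros) auto

lemma jet_radial_derivative:
  assumes K: "jet (ball 0 r) K" and p: "continuous_on (sphere 0 1) p" and s: "\<bar>s\<bar> < r"
  shows "((\<lambda>s. \<integral>w. p w * K is (s *\<^sub>R w) \<partial>usm) has_real_derivative
    (\<integral>w. p w * (\<Sum>k\<in>UNIV. w $ k * K (k # is) (s *\<^sub>R w)) \<partial>usm)) (at s)"
proof -
  have "((\<lambda>s. \<integral>w. p w * K is (0 + s *\<^sub>R w) \<partial>usm) has_real_derivative
    (\<integral>w. p w * (\<Sum>k\<in>UNIV. w $ k * K (k # is) (0 + s *\<^sub>R w)) \<partial>usm)) (at s)"
    using s
    by (intro usm_integral_line_derivative[OF jet_has_derivative[OF K] jet_continuous_on[OF K],
          where J = "{-r<..<r}"] continuous_intros p) auto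
  then show ?thesis by simp
qed

lemma W_s:
  assumes "\<bar>s\<bar> + \<bar>t\<bar> < \<rho>"
  shows "((\<lambda>s. \<integral>w. V [] t (s *\<^sub>R w) \<partial>usm) has_real_derivative P s t) (at s)"
proof -
  have "((\<lambda>s. \<integral>w. 1 * V [] t (s *\<^sub>R w) \<partial>usm) has_real_derivative
    (\<integral>w. 1 * (\<Sum>k\<in>UNIV. w $ k * V [k] t (s *\<^sub>R w)) \<partial>usm)) (at s)"
    by (rule jet_radial_derivative[OF V_jet]) (use assms in auto)
  moreover have "(\<integral>w. (\<Sum>k\<in>UNIV. w $ k * V [k] t (s *\<^sub>R w)) \<partial>usm) = P s t"
    unfolding P_def
    by (intro Bochner_Integration.integral_sum integrable_usm continuous_intros V_cont_sphere assms)
  ultimately show ?thesis by simp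
qed

lemma P_s:
  assumes "\<bar>s\<bar> + \<bar>t\<bar> < \<rho>"
  shows "((\<lambda>s. P s t) has_real_derivative Ps s t) (at s)"
  unfolding P_def Ps_def using assms
  by (intro DERIV_sum jet_radial_derivative[OF V_jet]) (auto intro!: continuous_intros)

lemma Q_s:
  assumes "\<bar>s\<bar> + \<bar>t\<bar> < \<rho>"
  shows "((\<lambda>s. Q s t) has_real_derivative X s t) (at s)"
proof -
  have "((\<lambda>s. \<integral>w. 1 * B [] t (s *\<^sub>R w) \<partial>usm) has_real_derivative
    (\<integral>w. 1 * (\<Sum>k\<in>UNIV. w $ k * B [k] t (s *\<^sub>R w)) \<partial>usm)) (at s)"
    by (rule jet_radial_derivative[OF B_jet]) (use assms in auto)
  moreover have "(\<integral>w. (\<Sum>k\<in>UNIV. w $ k * B [k] t (s *\<^sub>R w)) \<partial>usm) = X s t"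
    unfolding X_def
    by (intro Bochner_Integration.integral_sum integrable_usm continuous_intros B_cont_sphere assms)
  ultimately show ?thesis by (simp add: Q_def)
qed

text \<open>Together with \<open>Q_s\<close> this identifies both mixed derivatives of the iterated
  mean with the same function \<open>X\<close>, as the energy estimate requires.\<close>

lemma P_t:
  assumes "\<bar>s\<bar> + \<bar>t\<bar> < \<rho>"
  shows "((\<lambda>t. P s t) has_real_derivative X s t) (at t)"
  unfolding P_def X_def
proof (rule DERIV_sum)
  fix j
  have J: "open {- (\<rho> - \<bar>s\<bar>) <..< \<rho> - \<bar>s\<bar>}" "t \<in> {- (\<rho> - \<bar>s\<bar>) <..< \<rho> - \<bar>s\<bar>}" using assms by auto
  show "((\<lambda>t. \<integral>w. w $ j * V [j] t (s *\<^sub>R w) \<partial>usm) has_real_derivative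
      (\<integral>w. w $ j * B [j] t (s *\<^sub>R w) \<partial>usm)) (at t)"
    unfolding has_real_derivative_iff_has_vector_derivative
  proof (rule has_vector_derivative_usm_integral[OF J])
    fix r :: real and w :: "(real, 'n) vec"
    assume "r \<in> {- (\<rho> - \<bar>s\<bar>) <..< \<rho> - \<bar>s\<bar>}" "w \<in> sphere 0 1"
    then have "\<bar>r\<bar> + norm (s *\<^sub>R w) < \<rho>" by auto
    from DERIV_cmult[OF V_t[OF this]]
    show "((\<lambda>t. w $ j * V [j] t (s *\<^sub>R w)) has_vector_derivative w $ j * B [j] r (s *\<^sub>R w)) (at r)"
      unfolding has_real_derivative_iff_has_vector_derivative .
  qed (auto simp: split_beta intro!: continuous_intros B_joint_cont V_joint_cont)
qed

lemma Q_t: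
  assumes "0 < t" "\<bar>s\<bar> + t < \<rho>"
  shows "((\<lambda>t. t ^ (CARD('n) - 1) * Q s t) has_real_derivative t ^ (CARD('n) - 1) * L s t) (at t)"
proof -
  have J: "open {0 <..< \<rho> - \<bar>s\<bar>}" "t \<in> {0 <..< \<rho> - \<bar>s\<bar>}" using assms by auto
  have "((\<lambda>t. \<integral>w. t ^ (CARD('n) - 1) * B [] t (s *\<^sub>R w) \<partial>usm) has_real_derivative
      (\<integral>w. t ^ (CARD('n) - 1) * (\<Sum>i\<in>UNIV. V [i, i] t (s *\<^sub>R w)) \<partial>usm)) (at t)"
    unfolding has_real_derivative_iff_has_vector_derivative
  proof (rule has_vector_derivative_usm_integral[OF J])
    fix r :: real and w :: "(real, 'n) vec"
    assume "r \<in> {0 <..< \<rho> - \<bar>s\<bar>}" "w \<in> sphere 0 1"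
    then have "0 < r" "r + norm (s *\<^sub>R w) < \<rho>" by auto
    from B_t[OF this]
    show "((\<lambda>t. t ^ (CARD('n) - 1) * B [] t (s *\<^sub>R w)) has_vector_derivative
        r ^ (CARD('n) - 1) * (\<Sum>i\<in>UNIV. V [i, i] r (s *\<^sub>R w))) (at r)"
      unfolding has_real_derivative_iff_has_vector_derivative .
  qed (auto simp: split_beta intro!: continuous_intros B_joint_cont V_joint_cont)
  then show ?thesis by (simp add: Q_def L_def)
qed

text \<open>The mean of the Laplacian is now computed in the variable \<open>s\<close>, by
  \<open>usm_tangential\<close> for each \<open>V [i]\<close>. With \<open>Q_t\<close> this is the
  Euler-Poisson-Darboux equation.\<close>

lemma L_eq:
  assumes "0 < s" "s + \<bar>t\<bar> < \<rho>"
  shows "s * L s t = real (CARD('n) - 1) * P s t + s * Ps s t"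
proof -
  have "s * (\<integral>w. V [i, i] t (s *\<^sub>R w) \<partial>usm) =
      (real CARD('n) - 1) * (\<integral>w. w $ i * V [i] t (s *\<^sub>R w) \<partial>usm) +
      s * (\<integral>w. w $ i * (\<Sum>j\<in>UNIV. w $ j * V [j, i] t (s *\<^sub>R w)) \<partial>usm)" for i
    by (rule usm_tangential[OF jet_has_derivative[OF V_jet] jet_continuous_on[OF V_jet]]) (use assms in auto)
  moreover have "L s t = (\<Sum>i\<in>UNIV. \<integral>w. V [i, i] t (s *\<^sub>R w) \<partial>usm)"
    unfolding L_def using assms by (intro Bochner_Integration.integral_sum integrable_usm V_cont_sphere) auto
  moreover have "real (CARD('n) - 1) = real CARD('n) - 1"
    by (simp add: of_nat_diff Suc_leI)
  ultimately show ?thesis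
    by (simp add: P_def Ps_def sum_distrib_left sum.distrib)
qed

end

section \<open>From vanishing iterated means to vanishing functions\<close>

lemma jet_zero_derivatives:
  assumes F: "jet U F" and zero: "\<And>x. x \<in> U \<Longrightarrow> F [] x = 0" and "x \<in> U"
  shows "F is x = 0"
  using assms(3)
proof (induction "is" arbitrary: x)
  case (Cons i "is")
  have "(F is has_derivative (\<lambda>h. 0)) (at x)"
    by (rule has_derivative_transform_within_open[OF has_derivative_const jet_open[OF F] Cons.prems])
      (simp add: Cons.IH)
  from has_derivative_unique[OF this jet_has_derivative[OF F Cons.prems]]
  have "0 = (\<Sum>k\<in>UNIV. axis i 1 $ k * F (k # is) x)" by (rule fun_cong)
  then show ?case unfolding sum_axis_mult by simp
qed (rule zero)

text \<open>The energy estimate gives \<open>P = 0\<close>, so the iterated mean does not depend on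
  \<open>s\<close>; at \<open>s = 0\<close> it is a multiple of a mean about the origin.\<close>

lemma (in ball_jet) V_eq_zero:
  assumes n: "CARD('n) \<ge> 2" and R: "R > 0" and \<rho>: "\<rho> = R + \<epsilon>"
    and means: "\<And>is t. t \<in> {0..R} \<Longrightarrow> (\<integral>w. F is (t *\<^sub>R w) \<partial>usm) = 0"
    and zero: "\<And>is x. norm x \<le> R \<Longrightarrow> F is x = 0"
    and VR: "\<And>is x. norm x < \<epsilon> \<Longrightarrow> V is R x = 0"
    and s: "s \<in> {0..<\<epsilon>}" and t: "t \<in> {0<..R}"
  shows "(\<integral>w. V [] t (s *\<^sub>R w) \<partial>usm) = 0"
proof -
  have P_zero: "P r t = 0" if r: "r \<in> {0..<\<epsilon>}" for r
  proof (rule darboux_energy_vanishing[OF R, where m = "CARD('n) - 1" and \<epsilon> = \<epsilon> and P = P and Q = Q and Ps = Ps and X = X and L = L])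
    show "1 \<le> CARD('n) - 1" using n by linarith
    show "((\<lambda>s. P s t) has_real_derivative Ps s t) (at s)" "((\<lambda>s. Q s t) has_real_derivative X s t) (at s)"
      if "s \<in> {0..<\<epsilon>}" "t \<in> {0..R}" for s t
      using that \<rho> by (auto intro!: P_s Q_s)
    show "((\<lambda>t. P s t) has_real_derivative X s t) (at t)"
      "((\<lambda>t. t ^ (CARD('n) - 1) * Q s t) has_real_derivative t ^ (CARD('n) - 1) * L s t) (at t)"
      if "s \<in> {0..<\<epsilon>}" "t \<in> {0<..<R}" for s t
      using that \<rho> by (auto intro!: P_t Q_t simp del: One_nat_def)
    show "s * L s t = real (CARD('n) - 1) * P s t + s * Ps s t"
      if "s \<in> {0<..<\<epsilon>}" "t \<in> {0..R}" for s t
      using that \<rho> by (intro L_eq) auto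
    have dom: "\<bar>snd (fst z)\<bar> + norm (fst (fst z) *\<^sub>R snd z) < \<rho>"
      if "z \<in> ({0..<\<epsilon>} \<times> {0..R}) \<times> sphere 0 1" for z :: "(real \<times> real) \<times> (real, 'n) vec"
      using that \<rho> by auto
    note [continuous_intros] = V_joint_cont[OF _ _ dom] B_joint_cont[OF _ _ dom]
    show "continuous_on ({0..<\<epsilon>} \<times> {0..R}) (\<lambda>(s, t). P s t)"
      "continuous_on ({0..<\<epsilon>} \<times> {0..R}) (\<lambda>(s, t). Q s t)"
      "continuous_on ({0..<\<epsilon>} \<times> {0..R}) (\<lambda>(s, t). Ps s t)"
      "continuous_on ({0..<\<epsilon>} \<times> {0..R}) (\<lambda>(s, t). X s t)"
      unfolding P_def Q_def Ps_def X_def split_beta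
      by (intro continuous_on_sum continuous_on_usm_integral; unfold split_beta; intro continuous_intros; assumption)+
    show "P s R = 0" if "s \<in> {0..<\<epsilon>}" for s
    proof -
      have "(\<integral>w. w $ j * V [j] R (s *\<^sub>R w) \<partial>usm) = (\<integral>w. 0 \<partial>(usm :: (real, 'n) vec measure))" for j
        using that by (intro integral_usm_cong) (auto simp: VR)
      then show ?thesis by (simp add: P_def)
    qed
    show "P 0 t = 0" "Q 0 t = 0" if "t \<in> {0..R}" for t
    proof -
      have "V is t 0 = 0" for "is" using means[OF that] by (simp add: V_def)
      then show "P 0 t = 0" by (simp add: P_def)
      \<comment> \<open>These integrals carry the weight \<open>w $ i\<close>, so
        \<open>means\<close> does not apply; they vanish because \<open>F\<close> is zero on the
        closed ball of radius \<open>R\<close>.\<close>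
      have "(\<integral>w. w $ i * F (i # is) (t *\<^sub>R w) \<partial>usm) = (\<integral>w. 0 \<partial>(usm :: (real, 'n) vec measure))" for i "is"
        using that by (intro integral_usm_cong) (auto simp: zero)
      then have "B is t 0 = 0" for "is" by (simp add: B_def)
      then show "Q 0 t = 0" by (simp add: Q_def)
    qed
  qed (use r t in auto)
  let ?W = "\<lambda>s. \<integral>w. V [] t (s *\<^sub>R w) \<partial>usm"
  have d: "(?W has_real_derivative 0) (at r)" if "r \<in> {0..s}" for r
    using W_s[of r t] P_zero[of r] that s t \<rho> by auto
  have "?W s = ?W 0"
  proof (cases "s = 0")
    case False
    then have "0 < s" using s by simp
    then show ?thesis
    proof (rule DERIV_isconst_end)
      show "continuous_on {0..s} ?W"
        by (intro continuous_at_imp_continuous_on ballI) (metis DERIV_isCont d)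
      show "(?W has_real_derivative 0) (at r)" if "0 < r" "r < s" for r
        using that by (intro d) auto
    qed
  qed simp
  also have "\<dots> = 0" using means[of t "[]"] t by (simp add: V_def)
  finally show ?thesis .
qed

lemma jet_uniqueness:
  fixes F :: "'n list \<Rightarrow> real^'n::{finite,wellorder} \<Rightarrow> real"
  assumes n: "CARD('n) \<ge> 2" and R: "R > 0" and \<epsilon>: "\<epsilon> > 0" and F: "jet (ball 0 (R + \<epsilon>)) F"
    and means: "\<And>is t. t \<in> {0..R} \<Longrightarrow> (\<integral>w. F is (t *\<^sub>R w) \<partial>usm) = 0"
    and meanR: "\<And>x. x \<in> ball 0 \<epsilon> \<Longrightarrow> (\<integral>w. F [] (x + R *\<^sub>R w) \<partial>usm) = 0"
    and y: "y \<in> ball 0 (R + \<epsilon>)"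
  shows "F [] y = 0"
proof -
  define V where "V is t x = (\<integral>w. F is (x + t *\<^sub>R w) \<partial>usm)" for "is" t x
  have zero: "F is x = 0" if "norm x \<le> R" for "is" x
  proof (cases "x = 0")
    case True
    \<comment> \<open>The mean over the sphere of radius 0 settles the centre.\<close>
    then show ?thesis using means[of 0 "is"] R measure_usm_pos[where 'n='n] by simp
  next
    case False
    show ?thesis
      by (rule jet_zero_means_imp_zero[OF n F order_refl, of R]) (use False that means R \<epsilon> in auto)
  qed
  have V_jet: "jet (ball 0 (R + \<epsilon> - \<bar>t\<bar>)) (\<lambda>is. V is t)" for t
  proof -
    interpret F: ball_jet F "R + \<epsilon>" by unfold_locales (rule F)
    have "F.V = V" by (intro ext) (simp add: F.V_def V_def)
    then show ?thesis using F.V_jet[of t] by simp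
  qed
  \<comment> \<open>For \<open>t = R\<close> the domain of \<open>V_jet\<close> is exactly the ball
    of radius \<epsilon>, where \<open>V [] R\<close> vanishes by \<open>meanR\<close>; hence so do
    its derivatives.\<close>
  have VR: "V is R x = 0" if "norm x < \<epsilon>" for "is" x
    by (rule jet_zero_derivatives[OF V_jet[of R]]) (use that R meanR in \<open>auto simp: V_def\<close>)
  have V_means: "(\<integral>w. V is t (s *\<^sub>R w) \<partial>usm) = 0" if st: "s \<in> {0..<\<epsilon>}" "t \<in> {0<..R}" for s t "is"
  proof -
    \<comment> \<open>Starting from the jet of the derivative \<open>F is\<close> yields the
      statement for all derivatives of \<open>V [] t\<close>.\<close>
    interpret S: ball_jet "\<lambda>js. F (js @ is)" "R + \<epsilon>"
      by unfold_locales (rule jet_append[OF F])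
    have SV: "S.V js t x = V (js @ is) t x" for js t x
      by (simp add: S.V_def V_def)
    have "(\<integral>w. S.V [] t (s *\<^sub>R w) \<partial>usm) = 0"
      by (rule S.V_eq_zero[OF n R refl _ _ _ st]) (simp_all add: means zero SV VR)
    then show ?thesis by (simp add: SV)
  qed
  have V_zero: "V is t x = 0" if "x \<noteq> 0" "norm x < \<epsilon>" "t \<in> {0<..R}" for "is" t x
  proof (rule jet_zero_means_imp_zero[OF n V_jet[of t], of 0 \<epsilon> "norm x"])
    show "ball 0 \<epsilon> \<subseteq> ball 0 (R + \<epsilon> - \<bar>t\<bar>)" using that by auto
    show "(\<integral>w. V is t (0 + s *\<^sub>R w) \<partial>usm) = 0" if "0 < s" "s \<le> norm x" for "is" s
      using V_means[of s t "is"] that \<open>norm x < \<epsilon>\<close> \<open>t \<in> {0<..R}\<close> by simp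
  qed (use that in auto)
  show ?thesis
  proof (cases "norm y \<le> R")
    case False
    \<comment> \<open>\<open>x\<close> lies on the segment from 0 to \<open>y\<close> at distance
      \<open>R\<close> from \<open>y\<close>. So \<open>norm x = norm y - R\<close> is less than
      \<epsilon>, and \<open>y\<close> is on the sphere of radius \<open>R\<close> about
      \<open>x\<close>.\<close>
    define x where "x = (1 - R / norm y) *\<^sub>R y"
    have ny: "norm y > R" "norm y < R + \<epsilon>" using False y by auto
    have frac: "0 < 1 - R / norm y" using ny R by (simp add: divide_less_eq_1)
    have "norm x = (1 - R / norm y) * norm y"
      unfolding x_def norm_scaleR using frac by simp
    then have nx: "norm x = norm y - R" using ny R by (auto simp: left_diff_distrib)
    then have x0: "x \<noteq> 0" using ny by auto
    have "y - x = (R / norm y) *\<^sub>R y" by (simp add: x_def algebra_simps)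
    then have "norm (y - x) = R" using ny R by auto
    then have yx: "dist x y = R" by (simp add: dist_norm norm_minus_commute)
    have "ball x (R + \<epsilon> - norm x) \<subseteq> ball 0 (R + \<epsilon>)"
      by (simp add: ball_subset_ball_iff)
    then show ?thesis
    proof (rule jet_zero_means_imp_zero[OF n F, of x _ R])
      show "R < R + \<epsilon> - norm x" using nx ny by simp
      show "(\<integral>w. F is (x + s *\<^sub>R w) \<partial>usm) = 0" if "0 < s" "s \<le> R" for "is" s
        using V_zero[OF x0, of s "is"] nx ny that by (simp add: V_def)
      show "y \<noteq> x" "dist x y \<le> R" using yx R by auto
    qed
  qed (rule zero)
qed

text \<open>The class of \<open>'b\<close> covers real and complex values;
  \<open>jet_uniqueness\<close> is applied to the real functions
  \<open>f y \<bullet> b\<close>.\<close>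

theorem theorem2p3:
  fixes f :: "real^'n::{finite,wellorder} \<Rightarrow> 'b::{real_normed_field,euclidean_space}"
    and R \<epsilon> :: real
  assumes "CARD('n) \<ge> 2" and "R > 0" and "\<epsilon> > 0"
    and "Cinf_on (ball 0 (R + \<epsilon>)) f"
    and "\<And>\<alpha> t. t \<in> {0..R} \<Longrightarrow> multi_deriv \<alpha> (\<lambda>x. spherical_mean f x t) 0 = 0"
    and "\<And>x. x \<in> ball 0 \<epsilon> \<Longrightarrow> spherical_mean f x R = 0"
  shows "\<forall>x\<in>ball 0 (R + \<epsilon>). f x = 0"
proof
  fix y :: "real^'n::{finite,wellorder}" assume y: "y \<in> ball 0 (R + \<epsilon>)"
  note f = assms(4)
  \<comment> \<open>The normalising factor is nonzero, so it does not affect vanishing.\<close>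
  have mean: "pds is (\<lambda>x. spherical_mean f x t) x = 0 \<longleftrightarrow> (\<integral>w. pds is f (x + t *\<^sub>R w) \<partial>usm) = 0"
    if "t \<in> {0..R}" "x \<in> ball 0 \<epsilon>" for "is" t and x :: "(real, 'n) vec"
    using pds_spherical_mean[OF f, of t x "is"] that measure_usm_pos[where 'n='n] by auto
  have in_ball: "x + t *\<^sub>R w \<in> ball 0 (R + \<epsilon>)" if "t \<in> {0..R}" "x \<in> ball 0 \<epsilon>" "w \<in> sphere 0 1"
    for t and x w :: "(real, 'n) vec"
    using that norm_triangle_ineq[of x "t *\<^sub>R w"] by auto
  have integrable: "integrable usm (\<lambda>w. pds is f (x + t *\<^sub>R w))" if "t \<in> {0..R}" "x \<in> ball 0 \<epsilon>" for "is" t x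
    using in_ball[OF that]
    by (intro integrable_usm continuous_on_compose2[OF Cinf_on_continuous_on[OF Cinf_on_pds[OF f]]] continuous_intros) auto
  have vec0: "(\<integral>w. pds is f (t *\<^sub>R w) \<partial>usm) = 0" if t: "t \<in> {0..R}" for "is" t
  proof -
    obtain \<alpha> js where js: "mset js = mset is"
      "\<And>g :: (real, 'n) vec \<Rightarrow> 'b. multi_deriv \<alpha> g = pds js g"
      using ex_multi_deriv_pds[of "is"] by metis
    have 0: "(0 :: (real, 'n) vec) \<in> ball 0 \<epsilon>" using assms(3) by simp
    have "(\<integral>w. pds js f (0 + t *\<^sub>R w) \<partial>usm) = 0"
      using assms(5)[OF t, of \<alpha>] mean[OF t 0, of js] by (simp add: js(2))
    \<comment> \<open>The order of differentiation may be changed under the integral, since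
      \<open>pds_perm\<close> holds at every point of the sphere.\<close>
    moreover have "(\<integral>w. pds js f (0 + t *\<^sub>R w) \<partial>usm) = (\<integral>w. pds is f (0 + t *\<^sub>R w) \<partial>usm)"
      using in_ball[OF t 0] js(1) by (intro integral_usm_cong pds_perm[OF open_ball f]) auto
    ultimately show ?thesis by simp
  qed
  show "f y = 0"
  proof (rule euclidean_eqI)
    fix b :: 'b
    have "pds [] f y \<bullet> b = 0"
    proof (rule jet_uniqueness[OF assms(1-3) Cinf_on_jet[OF open_ball f] _ _ y])
      show "(\<integral>w. pds is f (t *\<^sub>R w) \<bullet> b \<partial>usm) = 0" if "t \<in> {0..R}" for "is" t
        using vec0[OF that, of "is"] integrable[OF that, of 0 "is"] assms(3) by simp
      show "(\<integral>w. pds [] f (x + R *\<^sub>R w) \<bullet> b \<partial>usm) = 0" if "x \<in> ball 0 \<epsilon>" for x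
        using mean[of R x "[]"] integrable[of R x "[]"] assms(2,6) that by simp
    qed
    then show "f y \<bullet> b = 0 \<bullet> b" by simp
  qed
qed

end
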